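(* Let $N=N(Q_n,m,r)$ be a quasi $Q_n$-filiform Lie algebra with the elements $e_{ij}$ and basis fixed in the context, and let $B$ be the $r\times(m-r)$ matrix with $(e_{1n}\ e_{2n}\ \cdots\ e_{mn})=(e_{1n}\ e_{2n}\ \cdots\ e_{rn})(I\ \ B)$. Let $\rho$ be a linear transformation of $N$ such that for every $1\le s\le m$ $$\rho e_{st}=\sum_{i=1}^{m}\sum_{j=0}^{n-1}b^{st}_{ij}e_{ij}+\sum_{i=1}^{r}b^{st}_{in}e_{in},\qquad t=0,1,$$ $$\rho e_{st}=[\rho e_{s0},\rho e_{s,t-1}],\qquad 2\le t\le n-1,$$ and $$\rho e_{sn}=-[\rho e_{s1},\rho e_{s,n-1}],\qquad 1\le s\le r,$$ where the $b^{st}_{ij}$ are complex numbers. Then $\rho$ is an automorphism of the Lie algebra $N$ if and only if the following conditions hold: (1) For every $s$ $(1\le s\le m)$ there exists only one integer $q_s$ $(1\le q_s\le m)$ such that $$\rho e_{s0}=b^{s0}_{q_s0}e_{q_s0}+\sum_{i=2}^{n-1}b^{s0}_{q_si}e_{q_si}+\sum_{i=1}^{r}b^{s0}_{in}e_{in},$$ $$\rho e_{s1}=\sum_{i=1}^{n-2}b^{s1}_{q_si}e_{q_si}+\sum_{i=1}^{m}b^{s1}_{i,n-1}e_{i,n-1}+\sum_{i=1}^{r}b^{s1}_{in}e_{in}.$$ (2) There exists a permutation matrix $T$ such that $(q_1\ q_2\ \cdots\ q_m)=(1\ 2\ \cdots\ m)T$. (3) For all $1\le s,p\le m$: $b^{s0}_{q_s0}b^{s1}_{q_s1}\ne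 0$ and $$b^{s1}_{q_s1}b^{p1}_{q_s,n-1}e_{q_sn}=b^{s1}_{q_p,n-1}b^{p1}_{q_p1}e_{q_pn}.$$ (4) For all $1\le s\le m$, $$\sum_{j=1}^{p}(-1)^jb^{s1}_{q_sj}b^{s1}_{q_s,p-j+1}=0,\qquad p=3,5,\ldots,n-2.$$ (5) $(I\ \ B)T_2K_2=(I\ \ B)T_1K_1B$, where $T=(T_1\ \ T_2)$ with $T_1$ an $m\times r$ matrix, $K_1=\mathrm{diag}(k_1,\ldots,k_r)$, $K_2=\mathrm{diag}(k_{r+1},\ldots,k_m)$, and $k_i=(b^{i0}_{q_i0})^{n-2}(b^{i1}_{q_i1})^2$.
   Context: All Lie algebras are finite dimensional over $\mathbb{C}$. The descending central series is $c^0N=N$, $c^iN=[N,c^{i-1}N]$. For $n=2d+1>3$, $Q_n$ is the $(n+1)$-dimensional Lie algebra with basis $e_0,e_1,\ldots,e_n$ and brackets $[e_0,e_i]=e_{i+1}$ ($1\le i\le n-2$), $[e_i,e_{n-i}]=(-1)^ie_n$ ($1\le i\le n-1$), all other brackets being zero or obtained by antisymmetry. A Lie algebra $N$ is a quasi $Q_n$-filiform Lie algebra, denoted $N(Q_n,m,r)$, if $N=N_1+N_2+\cdots+N_m$ (sum of subspaces, not necessarily direct) where each $N_i$ is a subalgebra isomorphic to $Q_n$, $[N_i,N_j]=0$ for $i\ne j$, and $r=\dim c^{n-1}N$. For each $i$, $e_{i0},e_{i1},\ldots,e_{in}$ is a basis of $N_i$ satisfying $[e_{i0},e_{ij}]=e_{i,j+1}$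 ($1\le j\le n-2$), $[e_{ij},e_{i,n-j}]=(-1)^je_{in}$ ($1\le j\le n-1$), all other brackets among $e_{i0},\ldots,e_{in}$ being zero or obtained by antisymmetry. The elements $e_{ij}$ ($1\le i\le m$, $0\le j\le n-1$) are linearly independent, $c^{n-1}N$ is spanned by $e_{1n},\ldots,e_{mn}$, and the $N_i$ are numbered so that the elements $e_{ij}$ ($1\le i\le m$, $0\le j\le n-1$) together with $e_{1n},\ldots,e_{rn}$ form a basis of $N$. $I$ denotes the $r\times r$ identity matrix. *)

theory Defs
  imports "Jordan_Normal_Form.Matrix"
begin

locale complex_lie_algebra = vector_space scale
  for scale :: "complex \<Rightarrow> 'a::ab_group_add \<Rightarrow> 'a" +
  fixes br :: "'a \<Rightarrow> 'a \<Rightarrow> 'a"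
  assumes finite_dim: "\<exists>S. finite S \<and> span S = UNIV"
    and br_add_left: "br (x + y) z = br x z + br y z"
    and br_add_right: "br x (y + z) = br x y + br x z"
    and br_scale_left: "br (scale c x) y = scale c (br x y)"
    and br_scale_right: "br x (scale c y) = scale c (br x y)"
    and br_self: "br x x = 0"
    and jacobi: "br x (br y z) + br y (br z x) + br z (br x y) = 0"
begin

definition subalgebra :: "'a set \<Rightarrow> bool" where
  "subalgebra V \<longleftrightarrow> subspace V \<and> (\<forall>x\<in>V. \<forall>y\<in>V. br x y \<in> V)"

definition automorphism :: "('a \<Rightarrow> 'a) \<Rightarrow> bool" where
  "automorphism \<phi> \<longleftrightarrow> Vector_Spaces.linear scale scale \<phi> \<and> bij \<phi> \<and>
     (\<forall>x y. \<phi> (br x y) = br (\<phi> x) (\<phi> y))"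

primrec lower_central :: "nat \<Rightarrow> 'a set" where
  "lower_central 0 = UNIV"
| "lower_central (Suc i) = span {br x y | x y. y \<in> lower_central i}"

text \<open>Bases are indexed families, so distinct indices give distinct vectors.\<close>

definition basis_family :: "'i set \<Rightarrow> ('i \<Rightarrow> 'a) \<Rightarrow> 'a set \<Rightarrow> bool" where
  "basis_family I f V \<longleftrightarrow> inj_on f I \<and> independent (f ` I) \<and> span (f ` I) = V"

text \<open>\<open>f 0, \<dots>, f n\<close> is a basis of \<open>V\<close> with the structure constants defining \<open>Q\<^sub>n\<close>.\<close>

definition Qn_basis :: "nat \<Rightarrow> 'a set \<Rightarrow> (nat \<Rightarrow> 'a) \<Rightarrow> bool" where
  "Qn_basis n V f \<longleftrightarrow> basis_family {0..n} f V \<and>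
     (\<forall>i\<in>{1..n-2}. br (f 0) (f i) = f (i + 1)) \<and>
     (\<forall>i\<in>{1..n-1}. br (f i) (f (n - i)) = scale ((-1) ^ i) (f n)) \<and>
     (\<forall>i\<in>{0..n}. \<forall>j\<in>{0..n}.
        \<not> (i = 0 \<and> j \<in> {1..n-2}) \<and> \<not> (j = 0 \<and> i \<in> {1..n-2}) \<and>
        \<not> (i \<in> {1..n-1} \<and> j = n - i) \<longrightarrow> br (f i) (f j) = 0)"

definition isomorphic_to_Qn :: "nat \<Rightarrow> 'a set \<Rightarrow> bool" where
  "isomorphic_to_Qn n V \<longleftrightarrow> (\<exists>f. Qn_basis n V f)"

text \<open>The whole algebra is \<open>N(Q\<^sub>n, m, r)\<close>, witnessed by the subalgebras \<open>Ns 1, \<dots>, Ns m\<close>.\<close>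

definition quasi_Qn_filiform :: "nat \<Rightarrow> nat \<Rightarrow> nat \<Rightarrow> (nat \<Rightarrow> 'a set) \<Rightarrow> bool" where
  "quasi_Qn_filiform n m r Ns \<longleftrightarrow> odd n \<and> n > 3 \<and> m \<ge> 1 \<and>
     (\<forall>x. \<exists>y. (\<forall>i\<in>{1..m}. y i \<in> Ns i) \<and> x = (\<Sum>i=1..m. y i)) \<and>
     (\<forall>i\<in>{1..m}. subalgebra (Ns i) \<and> isomorphic_to_Qn n (Ns i)) \<and>
     (\<forall>i\<in>{1..m}. \<forall>j\<in>{1..m}. i \<noteq> j \<longrightarrow> (\<forall>x\<in>Ns i. \<forall>y\<in>Ns j. br x y = 0)) \<and>
     r = dim (lower_central (n - 1))"

definition adapted_elements ::
  "nat \<Rightarrow> nat \<Rightarrow> nat \<Rightarrow> (nat \<Rightarrow> 'a set) \<Rightarrow> (nat \<Rightarrow> nat \<Rightarrow> 'a) \<Rightarrow> bool" where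
  "adapted_elements n m r Ns e \<longleftrightarrow> r \<le> m \<and>
     (\<forall>i\<in>{1..m}. Qn_basis n (Ns i) (e i)) \<and>
     span ((\<lambda>i. e i n) ` {1..m}) = lower_central (n - 1) \<and>
     basis_family ({1..m} \<times> {0..n-1} \<union> {1..r} \<times> {n}) (\<lambda>(i, j). e i j) UNIV"

end

definition append_cols :: "'a mat \<Rightarrow> 'a mat \<Rightarrow> 'a mat" where
  "append_cols A B = mat (dim_row A) (dim_col A + dim_col B)
     (\<lambda>(i, j). if j < dim_col A then A $$ (i, j) else B $$ (i, j - dim_col A))"

definition permutation_matrix :: "nat \<Rightarrow> complex mat \<Rightarrow> bool" where
  "permutation_matrix m T \<longleftrightarrow>
     (\<exists>\<pi>. \<pi> permutes {..<m} \<and> T = mat m m (\<lambda>(i, j). if i = \<pi> j then 1 else 0))"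

end

theory Submission
  imports Defs
begin

text \<open>
  Let \<open>X\<^sub>s, Y\<^sub>s\<close> be the images of \<open>e\<^sub>s\<^sub>0, e\<^sub>s\<^sub>1\<close>. If \<open>\<rho>\<close> is an automorphism, then \<open>\<rho> e\<^sub>s\<^sub>,\<^sub>n\<^sub>-\<^sub>1\<close> is not
  central, and its only noncentral coordinates are \<open>x\<^sup>n\<^sup>-\<^sup>3 D\<^sub>i\<close> at \<open>e\<^sub>i\<^sub>,\<^sub>n\<^sub>-\<^sub>1\<close>, where \<open>x\<close> is the
  coordinate of \<open>X\<^sub>s\<close> at \<open>e\<^sub>i\<^sub>0\<close> and \<open>D\<^sub>i\<close> is the minor of \<open>X\<^sub>s, Y\<^sub>s\<close> on \<open>e\<^sub>i\<^sub>0, e\<^sub>i\<^sub>1\<close>. So some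
  \<open>i = q\<^sub>s\<close> has \<open>x D\<^sub>i \<noteq> 0\<close>. At \<open>i = q\<^sub>s\<close> the \<open>(0, 1)\<close>-parts of \<open>X\<^sub>s, Y\<^sub>s\<close> span the plane, whereas
  those of \<open>X\<^sub>p, Y\<^sub>p\<close> with \<open>p \<noteq> s\<close> must be parallel to both of them because the brackets vanish;
  hence they are zero, and \<open>q\<close> is a permutation. The remaining vanishing brackets give
  the shape (1). Given this shape, all coordinates of \<open>\<rho> e\<^sub>s\<^sub>t\<close> are explicit shifts of those of
  \<open>Y\<^sub>s\<close>. Then (3) is \<open>[Y\<^sub>s, Y\<^sub>p] = 0\<close>, (4) is \<open>[Y\<^sub>s, \<rho> e\<^sub>s\<^sub>t] = 0\<close> for \<open>2 \<le> t \<le> n - 2\<close>, and (5) is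
  \<open>\<rho> e\<^sub>s\<^sub>n = k\<^sub>s e\<^sub>q\<^sub>n\<close> (with \<open>q = q\<^sub>s\<close>) for \<open>s > r\<close>, which is automatic for \<open>s \<le> r\<close>.
\<close>

section \<open>Bracket and coordinates\<close>

text \<open>The reflection \<open>j\<close> to \<open>p + 1 - j\<close> swaps the two factors and,
  as \<open>p + 1\<close> is odd, reverses the sign, so the sum equals its own negative. Hence
  condition (4) has content for odd \<open>p\<close> only.\<close>

lemma alternating_convolution_even_eq_0:
  fixes y :: "nat \<Rightarrow> complex"
  assumes "even p"
  shows "(\<Sum>j=1..p. (-1) ^ j * y j * y (p + 1 - j)) = 0"
proof -
  define f where "f j = (-1) ^ j * y j * y (p + 1 - j)" for j
  have "(\<Sum>j=1..p. f j) = (\<Sum>j=1..p. f (p + 1 - j))"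
    by (rule sum.reindex_bij_witness[of _ "\<lambda>j. p + 1 - j" "\<lambda>j. p + 1 - j"]) auto
  also have "\<dots> = (\<Sum>j=1..p. - f j)"
  proof (rule sum.cong[OF refl])
    fix j assume "j \<in> {1..p}"
    then have j: "1 \<le> j" "j \<le> p" by auto
    then have "odd (p + 1 - j) = even j"
      using assms by (simp add: even_diff_nat)
    then have "(-1 :: complex) ^ (p + 1 - j) = - ((-1) ^ j)"
      by (cases "even j") auto
    then show "f (p + 1 - j) = - f j"
      using j by (simp add: f_def)
  qed
  finally show ?thesis
    by (simp add: sum_negf f_def)
qed

section \<open>Bracket calculus and linear algebra in a general complex Lie algebra\<close>

context complex_lie_algebra
begin

lemma br_zero_left [simp]: "br 0 x = 0"
  using br_add_left[of 0 0 x] by simp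

lemma br_zero_right [simp]: "br x 0 = 0"
  using br_add_right[of x 0 0] by simp

lemma br_antisym: "br x y = - br y x"
proof -
  have "br (x + y) (x + y) = br x y + br y x"
    using br_self[of x] br_self[of y] by (simp add: br_add_left br_add_right)
  then show ?thesis
    using br_self[of "x + y"] by (simp add: eq_neg_iff_add_eq_0)
qed

lemma br_sum_left: "br (\<Sum>i\<in>I. f i) y = (\<Sum>i\<in>I. br (f i) y)"
  by (induction I rule: infinite_finite_induct) (auto simp: br_add_left)

lemma br_sum_right: "br x (\<Sum>i\<in>I. f i) = (\<Sum>i\<in>I. br x (f i))"
  by (induction I rule: infinite_finite_induct) (auto simp: br_add_right)

lemma preserves_br_if_on_spanning_set:
  assumes lin: "Vector_Spaces.linear scale scale f" and sp: "span S = UNIV"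
    and hom: "\<And>u v. u \<in> S \<Longrightarrow> v \<in> S \<Longrightarrow> f (br u v) = br (f u) (f v)"
  shows "f (br x y) = br (f x) (f y)"
proof -
  interpret f: Vector_Spaces.linear scale scale f by (fact lin)
  have step: "f (br u y) = br (f u) (f y)" if "u \<in> S" for u y
  proof -
    have "y \<in> span S" using sp by simp
    then show ?thesis
      by (induction rule: span_induct_alt)
         (use hom that in \<open>simp_all add: br_add_right br_scale_right f.add f.scale f.zero\<close>)
  qed
  have "x \<in> span S" using sp by simp
  then show ?thesis
    by (induction rule: span_induct_alt)
       (use step in \<open>simp_all add: br_add_left br_scale_left f.add f.scale f.zero\<close>)
qed

text \<open>An independent subset of a finite spanning set is a finite basis, over which surjective
  endomorphisms are injective. So only surjectivity of \<open>\<rho>\<close> has to be shown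
  later.\<close>

lemma linear_endo_surj_imp_inj:
  assumes "Vector_Spaces.linear scale scale f" "surj f"
  shows "inj f"
proof -
  obtain S where S: "finite S" "span S = UNIV" using finite_dim by auto
  obtain C where C: "C \<subseteq> S" "independent C" "S \<subseteq> span C"
    using maximal_independent_subset[of S] by auto
  have "span C = UNIV"
    using S(2) C(3) span_minimal[OF C(3) subspace_span] by auto
  then interpret finite_dimensional_vector_space scale C
    using C S(1) by unfold_locales (auto intro: finite_subset)
  show ?thesis using linear_surj_imp_inj assms by blast
qed

text \<open>The bracket splits into the action of \<open>f 0\<close>, which shifts indices by one
  and kills \<open>f (n - 1)\<close>, and the pairing of the \<open>f j\<close> with
  \<open>j \<ge> 1\<close>, which lands on \<open>f n\<close>. The sums stop at \<open>n - 1\<close>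
  because \<open>f n\<close> is central.\<close>

lemma br_Qn_expansion:
  assumes Q: "Qn_basis n V f" and n: "n > 1"
  shows "br (\<Sum>j=0..n-1. scale (\<alpha> j) (f j)) (\<Sum>j=0..n-1. scale (\<beta> j) (f j)) =
     (\<Sum>j=1..n-2. scale (\<alpha> 0 * \<beta> j - \<beta> 0 * \<alpha> j) (f (j + 1)))
     + scale (\<Sum>j=1..n-1. (-1) ^ j * \<alpha> j * \<beta> (n - j)) (f n)"
proof -
  have zero: "\<forall>i\<in>{0..n}. \<forall>j\<in>{0..n}.
        \<not> (i = 0 \<and> j \<in> {1..n-2}) \<and> \<not> (j = 0 \<and> i \<in> {1..n-2}) \<and>
        \<not> (i \<in> {1..n-1} \<and> j = n - i) \<longrightarrow> br (f i) (f j) = 0"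
    using Q by (simp add: Qn_basis_def)
  have z: "br (f 0) (f (n - 1)) = 0"
    by (rule zero[rule_format]) (use n in auto)
  have one: "br (f 0) (f j) = f (j + 1)" if "1 \<le> j" "j \<le> n - 2" for j
    using Q that unfolding Qn_basis_def by auto
  have two: "br (f i) (f j) = (if j = n - i then scale ((-1) ^ i) (f n) else 0)"
    if "1 \<le> i" "i \<le> n - 1" "1 \<le> j" "j \<le> n - 1" for i j
    using Q that unfolding Qn_basis_def by auto
  have ins: "{0..n-1} = insert 0 {1..n-1}" by auto
  have ins2: "{1..n-1} = insert (n - 1) {1..n-2}" using n by auto
  have ad0: "br (f 0) (\<Sum>j=1..n-1. scale (\<gamma> j) (f j)) = (\<Sum>j=1..n-2. scale (\<gamma> j) (f (j + 1)))" for \<gamma>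
  proof -
    have "br (f 0) (\<Sum>j=1..n-1. scale (\<gamma> j) (f j)) = (\<Sum>j=1..n-1. scale (\<gamma> j) (br (f 0) (f j)))"
      by (simp add: br_sum_right br_scale_right)
    also have "\<dots> = (\<Sum>j=1..n-2. scale (\<gamma> j) (br (f 0) (f j)))"
    proof (cases "n = 2")
      case False
      then show ?thesis using n unfolding ins2 by (subst sum.insert) (use z in auto)
    qed (use z in simp)
    finally show ?thesis using one by simp
  qed
  define A where "A = (\<Sum>j=1..n-1. scale (\<alpha> j) (f j))"
  define B where "B = (\<Sum>j=1..n-1. scale (\<beta> j) (f j))"
  have AB: "br A B = scale (\<Sum>j=1..n-1. (-1) ^ j * \<alpha> j * \<beta> (n - j)) (f n)"
  proof -
    have "br A B = (\<Sum>i=1..n-1. \<Sum>j=1..n-1. scale (\<alpha> i * \<beta> j) (br (f i) (f j)))"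
      unfolding A_def br_sum_left
      by (simp add: B_def br_sum_right br_scale_left br_scale_right scale_sum_right mult.commute)
    also have "\<dots> = (\<Sum>i=1..n-1. \<Sum>j=1..n-1. if j = n - i then scale ((-1) ^ i * \<alpha> i * \<beta> j) (f n) else 0)"
      by (intro sum.cong refl) (auto simp: two mult_ac)
    also have "\<dots> = (\<Sum>i=1..n-1. scale ((-1) ^ i * \<alpha> i * \<beta> (n - i)) (f n))"
      by (intro sum.cong refl) (auto simp: sum.delta)
    finally show ?thesis by (simp add: scale_sum_left)
  qed
  have "br (\<Sum>j=0..n-1. scale (\<alpha> j) (f j)) (\<Sum>j=0..n-1. scale (\<beta> j) (f j))
     = br (scale (\<alpha> 0) (f 0) + A) (scale (\<beta> 0) (f 0) + B)"
    unfolding ins A_def B_def by (subst (1 2) sum.insert) auto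
  also have "\<dots> = scale (\<alpha> 0) (br (f 0) B) - scale (\<beta> 0) (br (f 0) A) + br A B"
    using br_antisym[of A "f 0"]
    by (simp add: br_add_left br_add_right br_scale_left br_scale_right br_self)
  also have "scale (\<alpha> 0) (br (f 0) B) - scale (\<beta> 0) (br (f 0) A)
     = (\<Sum>j=1..n-2. scale (\<alpha> 0 * \<beta> j - \<beta> 0 * \<alpha> j) (f (j + 1)))"
    unfolding A_def B_def ad0
    by (simp add: scale_sum_right sum_subtractf scale_left_diff_distrib)
  finally show ?thesis unfolding AB .
qed

end

locale adapted_quasi_Qn = complex_lie_algebra scale br
  for scale :: "complex \<Rightarrow> 'a::ab_group_add \<Rightarrow> 'a" and br +
  fixes n m r :: nat and Ns :: "nat \<Rightarrow> 'a set" and e :: "nat \<Rightarrow> nat \<Rightarrow> 'a" and B :: "complex mat"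
  assumes quasi: "quasi_Qn_filiform n m r Ns"
    and adapted: "adapted_elements n m r Ns e"
    and B_carrier: "B \<in> carrier_mat r (m - r)"
    and top_expansion: "k \<in> {1..m} \<Longrightarrow>
           e k n = (\<Sum>i=1..r. scale (append_cols (1\<^sub>m r) B $$ (i - 1, k - 1)) (e i n))"
begin

lemma odd_n: "odd n" and n_ge: "n \<ge> 5" and r_le: "r \<le> m"
proof -
  show "odd n" "r \<le> m"
    using quasi adapted by (auto simp: quasi_Qn_filiform_def adapted_elements_def)
  have "n > 3" using quasi by (auto simp: quasi_Qn_filiform_def)
  with \<open>odd n\<close> show "n \<ge> 5" by (cases "n = 4") auto
qed

lemma Qn: "i \<in> {1..m} \<Longrightarrow> Qn_basis n (Ns i) (e i)"
  using adapted by (auto simp: adapted_elements_def)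

lemma e_in_Ns: "i \<in> {1..m} \<Longrightarrow> j \<le> n \<Longrightarrow> e i j \<in> Ns i"
  using Qn[of i] span_base[of "e i j" "e i ` {0..n}"]
  by (auto simp: Qn_basis_def basis_family_def)

lemma br_distinct: "br (e i j) (e k l) = 0"
  if "i \<in> {1..m}" "k \<in> {1..m}" "i \<noteq> k" "j \<le> n" "l \<le> n"
  using quasi that e_in_Ns by (auto simp: quasi_Qn_filiform_def)

lemma e_top_nonzero: "i \<in> {1..m} \<Longrightarrow> e i n \<noteq> 0"
  using Qn[of i] dependent_zero[of "e i ` {0..n}"] imageI[of n "{0..n}" "e i"]
  by (auto simp: Qn_basis_def basis_family_def)

lemma br_same:
  assumes "i \<in> {1..m}"
  shows "1 \<le> j \<Longrightarrow> j \<le> n - 2 \<Longrightarrow> br (e i 0) (e i j) = e i (Suc j)"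
    and "1 \<le> j \<Longrightarrow> j \<le> n - 1 \<Longrightarrow> br (e i j) (e i (n - j)) = scale ((-1) ^ j) (e i n)"
    and "1 \<le> j \<Longrightarrow> 1 \<le> k \<Longrightarrow> j \<le> n \<Longrightarrow> k \<le> n \<Longrightarrow> j + k \<noteq> n \<Longrightarrow> br (e i j) (e i k) = 0"
    and "br (e i 0) (e i (n - 1)) = 0"
    and "j \<le> n \<Longrightarrow> br (e i n) (e i j) = 0"
proof -
  have Q: "\<forall>i'\<in>{1..n-2}. br (e i 0) (e i i') = e i (i' + 1)"
    "\<forall>i'\<in>{1..n-1}. br (e i i') (e i (n - i')) = scale ((-1) ^ i') (e i n)"
    "\<forall>i'\<in>{0..n}. \<forall>j\<in>{0..n}.
        \<not> (i' = 0 \<and> j \<in> {1..n-2}) \<and> \<not> (j = 0 \<and> i' \<in> {1..n-2}) \<and>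
        \<not> (i' \<in> {1..n-1} \<and> j = n - i') \<longrightarrow> br (e i i') (e i j) = 0"
    using Qn[OF assms] by (simp_all add: Qn_basis_def)
  show "1 \<le> j \<Longrightarrow> j \<le> n - 2 \<Longrightarrow> br (e i 0) (e i j) = e i (Suc j)"
    using Q(1) by simp
  show "1 \<le> j \<Longrightarrow> j \<le> n - 1 \<Longrightarrow> br (e i j) (e i (n - j)) = scale ((-1) ^ j) (e i n)"
    using Q(2) by simp
  show "1 \<le> j \<Longrightarrow> 1 \<le> k \<Longrightarrow> j \<le> n \<Longrightarrow> k \<le> n \<Longrightarrow> j + k \<noteq> n \<Longrightarrow> br (e i j) (e i k) = 0"
    by (rule Q(3)[rule_format]) auto
  show "br (e i 0) (e i (n - 1)) = 0"
    by (rule Q(3)[rule_format]) (use n_ge in auto)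
  show "j \<le> n \<Longrightarrow> br (e i n) (e i j) = 0"
    by (rule Q(3)[rule_format]) (use n_ge in auto)
qed

section \<open>Coordinates in the adapted basis\<close>

definition idx :: "(nat \<times> nat) set" where
  "idx = {1..m} \<times> {0..n-1} \<union> {1..r} \<times> {n}"

definition basis :: "'a set" where
  "basis = (\<lambda>(i, j). e i j) ` idx"

lemma idx_inj: "inj_on (\<lambda>(i, j). e i j) idx"
  and basis_indep: "independent basis"
  and basis_span: "span basis = UNIV"
  using adapted by (auto simp: adapted_elements_def basis_family_def basis_def idx_def)

lemma finite_idx: "finite idx"
  by (simp add: idx_def)

text \<open>A genuine coordinate functional only for \<open>(i, j)\<close> in \<open>idx\<close>:
  for \<open>r < i\<close> the vector \<open>e i n\<close> is a combination of \<open>e 1 n\<close>,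
  ..., \<open>e r n\<close> and has no coordinate of its own.\<close>

definition coord :: "nat \<Rightarrow> nat \<Rightarrow> 'a \<Rightarrow> complex" where
  "coord i j x = representation basis x (e i j)"

lemma coord_add: "coord i j (x + y) = coord i j x + coord i j y"
  by (simp add: coord_def representation_add basis_indep basis_span)

lemma coord_scale: "coord i j (scale c x) = c * coord i j x"
  by (simp add: coord_def representation_scale basis_indep basis_span)

lemma coord_zero: "coord i j 0 = 0"
  by (simp add: coord_def representation_zero)

lemma coord_sum: "coord i j (\<Sum>k\<in>K. f k) = (\<Sum>k\<in>K. coord i j (f k))"
  by (simp add: coord_def representation_sum basis_indep basis_span)

lemma coord_e:
  assumes "(i, j) \<in> idx" "(k, l) \<in> idx"
  shows "coord i j (e k l) = (if i = k \<and> j = l then 1 else 0)"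
proof -
  have "e k l \<in> basis" using assms(2) by (force simp: basis_def)
  then show ?thesis
    using inj_onD[OF idx_inj _ assms] by (auto simp: coord_def representation_basis basis_indep)
qed

lemmas coord_linear = coord_add coord_scale coord_zero coord_sum

lemma coord_low:
  assumes "i \<in> {1..m}" "j \<le> n - 1" "k \<in> {1..m}" "l \<le> n - 1"
  shows "coord i j (e k l) = (if i = k \<and> j = l then 1 else 0)"
  using assms by (intro coord_e) (auto simp: idx_def)

text \<open>For \<open>r < k\<close> the vector \<open>e k n\<close> is expanded through
  \<open>B\<close>, which involves top basis vectors only.\<close>

lemma coord_top:
  assumes "i \<in> {1..m}" "j \<le> n - 1" "k \<in> {1..m}"
  shows "coord i j (e k n) = 0"
proof -
  have "coord i j (e l n) = 0" if "l \<in> {1..r}" for l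
    using assms that n_ge by (subst coord_e) (auto simp: idx_def)
  then show ?thesis
    by (subst top_expansion[OF assms(3)]) (simp add: coord_sum coord_scale)
qed

lemma coord_top_top:
  assumes "i \<in> {1..r}" "k \<in> {1..r}"
  shows "coord i n (e k n) = (if i = k then 1 else 0)"
  using assms by (subst coord_e) (auto simp: idx_def)

lemma coord_expansion:
  "x = (\<Sum>i=1..m. \<Sum>j=0..n-1. scale (coord i j x) (e i j)) + (\<Sum>i=1..r. scale (coord i n x) (e i n))"
proof -
  have "x = (\<Sum>v\<in>basis. scale (representation basis x v) v)"
    by (rule sum_representation_eq[symmetric])
       (simp_all add: basis_indep basis_span, simp add: basis_def finite_idx)
  also have "\<dots> = (\<Sum>p\<in>idx. scale (representation basis x (case p of (i, j) \<Rightarrow> e i j)) (case p of (i, j) \<Rightarrow> e i j))"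
    using sum.reindex[OF idx_inj, of "\<lambda>v. scale (representation basis x v) v"]
    by (simp add: basis_def[symmetric] o_def)
  also have "\<dots> = (\<Sum>(i,j)\<in>idx. scale (coord i j x) (e i j))"
    by (intro sum.cong refl) (auto simp: coord_def)
  also have "\<dots> = (\<Sum>(i,j)\<in>{1..m} \<times> {0..n-1}. scale (coord i j x) (e i j))
      + (\<Sum>(i,j)\<in>{1..r} \<times> {n}. scale (coord i j x) (e i j))"
    unfolding idx_def using n_ge by (intro sum.union_disjoint) auto
  also have "\<dots> = (\<Sum>i=1..m. \<Sum>j=0..n-1. scale (coord i j x) (e i j)) + (\<Sum>i=1..r. scale (coord i n x) (e i n))"
    by (simp add: sum.cartesian_product[symmetric])
  finally show ?thesis .
qed

lemma span_e: "span {e i j | i j. i \<in> {1..m} \<and> j \<le> n} = UNIV"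
proof -
  have "basis \<subseteq> {e i j | i j. i \<in> {1..m} \<and> j \<le> n}"
    unfolding basis_def idx_def using r_le by (intro image_subsetI) (clarsimp, fastforce)
  then show ?thesis using span_mono basis_span by blast
qed

lemma br_top_left [simp]:
  assumes i: "i \<in> {1..m}"
  shows "br (e i n) x = 0"
proof -
  have "x \<in> span {e i j | i j. i \<in> {1..m} \<and> j \<le> n}" using span_e by simp
  then show ?thesis
  proof (induction rule: span_induct_alt)
    case (step c y z)
    then obtain k l where "y = e k l" "k \<in> {1..m}" "l \<le> n" by auto
    then have "br (e i n) y = 0"
      using br_same(5)[OF i] br_distinct[OF i] by (cases "k = i") auto
    then show ?case using step by (simp add: br_add_right br_scale_right)
  qed simp
qed

lemma br_top_right [simp]: "i \<in> {1..m} \<Longrightarrow> br x (e i n) = 0"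
  by (subst br_antisym) simp

text \<open>The coefficient of \<open>e i n\<close> contributed by the summand \<open>Ns i\<close>
  to a bracket. For \<open>r < m\<close> the top vectors are linearly dependent, so a vanishing
  bracket does not by itself force these numbers to be zero.\<close>

definition \<omega> :: "nat \<Rightarrow> 'a \<Rightarrow> 'a \<Rightarrow> complex" where
  "\<omega> i x y = (\<Sum>j=1..n-1. (-1) ^ j * coord i j x * coord i (n - j) y)"

text \<open>The central top parts and the brackets across different summands drop out, leaving
  \<open>br_Qn_expansion\<close> in each summand.\<close>

lemma br_expansion:
  "br x y = (\<Sum>i=1..m. (\<Sum>j=1..n-2. scale (coord i 0 x * coord i j y - coord i 0 y * coord i j x) (e i (j + 1)))
     + scale (\<omega> i x y) (e i n))"
proof -
  define P where "P i x = (\<Sum>j=0..n-1. scale (coord i j x) (e i j))" for i x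
  define Z where "Z x = (\<Sum>i=1..r. scale (coord i n x) (e i n))" for x
  have Zl: "br (Z x) y = 0" for x y
    using r_le by (simp add: Z_def br_sum_left br_scale_left)
  have Zr: "br y (Z x) = 0" for x y
    using Zl[of x y] by (subst br_antisym) simp
  have dec: "x = (\<Sum>i=1..m. P i x) + Z x" for x
    unfolding P_def Z_def by (rule coord_expansion)
  have cross: "br (P i x) (P k y) = 0" if "i \<in> {1..m}" "k \<in> {1..m}" "i \<noteq> k" for i k
    using that n_ge
    by (auto simp: P_def br_sum_left br_sum_right br_scale_left br_scale_right br_distinct intro!: sum.neutral)
  have "br x y = br ((\<Sum>i=1..m. P i x) + Z x) ((\<Sum>i=1..m. P i y) + Z y)"
    by (rule arg_cong2[where f = br]) (rule dec)+
  also have "\<dots> = (\<Sum>i=1..m. \<Sum>k=1..m. br (P i x) (P k y))"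
    by (simp add: br_add_left br_add_right Zl Zr br_sum_left) (simp add: br_sum_right)
  also have "\<dots> = (\<Sum>i=1..m. \<Sum>k=1..m. if k = i then br (P i x) (P i y) else 0)"
    by (intro sum.cong refl) (use cross in auto)
  also have "\<dots> = (\<Sum>i=1..m. br (P i x) (P i y))"
    by (intro sum.cong refl) (auto simp: sum.delta)
  also have "\<dots> = (\<Sum>i=1..m. (\<Sum>j=1..n-2. scale (coord i 0 x * coord i j y - coord i 0 y * coord i j x) (e i (j + 1)))
     + scale (\<omega> i x y) (e i n))"
    unfolding P_def \<omega>_def using n_ge
    by (intro sum.cong refl br_Qn_expansion[of n "Ns _", OF Qn]) auto
  finally show ?thesis .
qed

text \<open>Below the top only the shift by \<open>e i 0\<close> is visible, so these coordinates
  are 2x2 minors; a vanishing bracket makes them all zero.\<close>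

lemma coord_br_Suc:
  assumes i: "i \<in> {1..m}" and j: "1 \<le> j" "j \<le> n - 2"
  shows "coord i (Suc j) (br x y) = coord i 0 x * coord i j y - coord i 0 y * coord i j x"
proof -
  define g where "g k l = coord k 0 x * coord k l y - coord k 0 y * coord k l x" for k l
  have "coord i (Suc j) (br x y) = (\<Sum>k=1..m. \<Sum>l=1..n-2. g k l * coord i (Suc j) (e k (l + 1)))"
    unfolding br_expansion[of x y] g_def[symmetric]
    using i j by (simp add: coord_linear coord_top)
  also have "\<dots> = (\<Sum>k=1..m. if k = i then g i j else 0)"
  proof (intro sum.cong refl)
    fix k assume k: "k \<in> {1..m}"
    have "(\<Sum>l=1..n-2. g k l * coord i (Suc j) (e k (l + 1))) = (\<Sum>l=1..n-2. if l = j then (if k = i then g i j else 0) else 0)"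
      using i j k n_ge by (intro sum.cong refl) (auto simp: coord_low)
    then show "(\<Sum>l=1..n-2. g k l * coord i (Suc j) (e k (l + 1))) = (if k = i then g i j else 0)"
      using j by (simp add: sum.delta)
  qed
  finally show ?thesis using i by (simp add: sum.delta g_def)
qed

lemma coord_br_0_1:
  assumes i: "i \<in> {1..m}" and j: "j \<le> 1"
  shows "coord i j (br x y) = 0"
  unfolding br_expansion[of x y]
  using i j n_ge
  by (auto simp: coord_linear coord_top coord_low intro!: sum.neutral)

lemma br_central:
  assumes "\<And>i j. i \<in> {1..m} \<Longrightarrow> 1 \<le> j \<Longrightarrow> j \<le> n - 2 \<Longrightarrow> coord i 0 x * coord i j y = coord i 0 y * coord i j x"
  shows "br x y = (\<Sum>i=1..m. scale (\<omega> i x y) (e i n))"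
  unfolding br_expansion[of x y] using assms by simp

lemma coord_of_br_zero:
  assumes "br x y = 0" "i \<in> {1..m}" "1 \<le> j" "j \<le> n - 2"
  shows "coord i 0 x * coord i j y = coord i 0 y * coord i j x"
  using coord_br_Suc[OF assms(2-4), of x y] assms(1) by (simp add: coord_zero)

lemma coord_diff: "coord i j (x - y) = coord i j x - coord i j y"
  by (simp add: coord_def representation_diff basis_indep basis_span)

lemma coord_eqI:
  assumes "\<And>i j. i \<in> {1..m} \<Longrightarrow> j \<le> n - 1 \<Longrightarrow> coord i j x = coord i j y"
    and "\<And>i. i \<in> {1..r} \<Longrightarrow> coord i n x = coord i n y"
  shows "x = y"
proof -
  have "(\<Sum>i=1..m. \<Sum>j=0..n-1. scale (coord i j x) (e i j)) + (\<Sum>i=1..r. scale (coord i n x) (e i n))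
    = (\<Sum>i=1..m. \<Sum>j=0..n-1. scale (coord i j y) (e i j)) + (\<Sum>i=1..r. scale (coord i n y) (e i n))"
    using assms by simp
  then show ?thesis
    unfolding coord_expansion[symmetric] .
qed

section \<open>Subspace membership and vanishing brackets read off from coordinates\<close>

lemma mem_subspace_if_coords:
  assumes W: "subspace W"
    and "\<And>i j. i \<in> {1..m} \<Longrightarrow> j \<le> n - 1 \<Longrightarrow> coord i j x \<noteq> 0 \<Longrightarrow> e i j \<in> W"
    and "\<And>i. i \<in> {1..r} \<Longrightarrow> e i n \<in> W"
  shows "x \<in> W"
proof -
  have "scale (coord i j x) (e i j) \<in> W" if "i \<in> {1..m}" "j \<le> n - 1" for i j
    using assms(2)[OF that] W subspace_0[OF W]
    by (cases "coord i j x = 0") (auto intro: subspace_scale)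
  then have "(\<Sum>i=1..m. \<Sum>j=0..n-1. scale (coord i j x) (e i j)) + (\<Sum>i=1..r. scale (coord i n x) (e i n)) \<in> W"
    using W assms(3) by (intro subspace_add subspace_sum) (auto intro: subspace_scale)
  then show ?thesis
    unfolding coord_expansion[symmetric] .
qed

text \<open>A step of triangular elimination: all other terms of \<open>x\<close> already lie in
  \<open>W\<close>, so the leading one does too. It is applied to
  \<open>W = range \<rho>\<close>.\<close>

lemma e_mem_subspace_if_leading:
  assumes W: "subspace W" and x: "x \<in> W" and kl: "k \<in> {1..m}" "l \<le> n - 1" "coord k l x \<noteq> 0"
    and rest: "\<And>i j. i \<in> {1..m} \<Longrightarrow> j \<le> n - 1 \<Longrightarrow> (i, j) \<noteq> (k, l) \<Longrightarrow> coord i j x \<noteq> 0 \<Longrightarrow> e i j \<in> W"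
    and top: "\<And>i. i \<in> {1..r} \<Longrightarrow> e i n \<in> W"
  shows "e k l \<in> W"
proof -
  define y where "y = x - scale (coord k l x) (e k l)"
  have "y \<in> W"
  proof (rule mem_subspace_if_coords[OF W _ top])
    fix i j assume ij: "i \<in> {1..m}" "j \<le> n - 1" "coord i j y \<noteq> 0"
    then have "(i, j) \<noteq> (k, l)" "coord i j x \<noteq> 0"
      using kl by (auto simp: y_def coord_diff coord_scale coord_low split: if_splits)
    then show "e i j \<in> W" using rest ij by blast
  qed
  then have "scale (inverse (coord k l x)) (x - y) \<in> W"
    using W x by (intro subspace_scale subspace_diff)
  then show ?thesis using kl by (simp add: y_def)
qed

lemma \<omega>_eq_0:
  assumes "\<And>j. 1 \<le> j \<Longrightarrow> j \<le> n - 1 \<Longrightarrow> coord i j x = 0 \<or> coord i (n - j) y = 0"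
  shows "\<omega> i x y = 0"
  unfolding \<omega>_def using assms by (intro sum.neutral) auto

lemma br_eq_0I:
  assumes "\<And>i j. i \<in> {1..m} \<Longrightarrow> 1 \<le> j \<Longrightarrow> j \<le> n - 2 \<Longrightarrow> coord i 0 x * coord i j y = coord i 0 y * coord i j x"
    and "\<And>i j. i \<in> {1..m} \<Longrightarrow> 1 \<le> j \<Longrightarrow> j \<le> n - 1 \<Longrightarrow> coord i j x = 0 \<or> coord i (n - j) y = 0"
  shows "br x y = 0"
proof -
  have "br x y = (\<Sum>i=1..m. scale (\<omega> i x y) (e i n))"
    by (rule br_central) (fact assms(1))
  also have "\<dots> = 0"
    using assms(2) by (intro sum.neutral) (auto simp: \<omega>_eq_0)
  finally show ?thesis .
qed

end

section \<open>Endomorphisms that permute the summands\<close>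

locale adapted_endomorphism = adapted_quasi_Qn scale br n m r Ns e B
  for scale :: "complex \<Rightarrow> 'a::ab_group_add \<Rightarrow> 'a" and br n m r Ns e B +
  fixes \<rho> :: "'a \<Rightarrow> 'a" and b :: "nat \<Rightarrow> nat \<Rightarrow> nat \<Rightarrow> nat \<Rightarrow> complex"
  assumes linear_rho: "Vector_Spaces.linear scale scale \<rho>"
    and rho_gen: "s \<in> {1..m} \<Longrightarrow> t \<in> {0, 1} \<Longrightarrow>
           \<rho> (e s t) = (\<Sum>i=1..m. \<Sum>j=0..n-1. scale (b s t i j) (e i j))
                     + (\<Sum>i=1..r. scale (b s t i n) (e i n))"
    and rho_rec: "s \<in> {1..m} \<Longrightarrow> t \<in> {2..n-1} \<Longrightarrow>
           \<rho> (e s t) = br (\<rho> (e s 0)) (\<rho> (e s (t - 1)))"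
    and rho_top: "s \<in> {1..r} \<Longrightarrow> \<rho> (e s n) = - br (\<rho> (e s 1)) (\<rho> (e s (n - 1)))"
begin

sublocale rho: Vector_Spaces.linear scale scale \<rho>
  by (fact linear_rho)

lemma rho_Suc:
  assumes "s \<in> {1..m}" "1 \<le> t" "t \<le> n - 2"
  shows "\<rho> (e s (Suc t)) = br (\<rho> (e s 0)) (\<rho> (e s t))"
  using rho_rec[of s "Suc t"] assms n_ge by auto

lemma coord_rho_gen:
  assumes s: "s \<in> {1..m}" "t \<in> {0, 1}" and i: "i \<in> {1..m}" and j: "j \<le> n - 1"
  shows "coord i j (\<rho> (e s t)) = b s t i j"
proof -
  have "coord i j (\<rho> (e s t)) = (\<Sum>k=1..m. \<Sum>l=0..n-1. b s t k l * coord i j (e k l))"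
    using i j r_le by (simp only: rho_gen[OF s] coord_linear) (simp add: coord_top)
  also have "\<dots> = (\<Sum>k=1..m. \<Sum>l=0..n-1. if l = j then (if k = i then b s t i j else 0) else 0)"
    using i j by (intro sum.cong refl) (auto simp: coord_low)
  also have "\<dots> = (\<Sum>k=1..m. if k = i then b s t i j else 0)"
    using j by (intro sum.cong refl) (simp add: sum.delta)
  finally show ?thesis using i by (simp add: sum.delta)
qed

definition normal_form :: "nat \<Rightarrow> nat \<Rightarrow> bool" where
  "normal_form s k \<longleftrightarrow>
     \<rho> (e s 0) = scale (b s 0 k 0) (e k 0)
               + (\<Sum>i=2..n-1. scale (b s 0 k i) (e k i))
               + (\<Sum>i=1..r. scale (b s 0 i n) (e i n)) \<and>
     \<rho> (e s 1) = (\<Sum>i=1..n-2. scale (b s 1 k i) (e k i))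
               + (\<Sum>i=1..m. scale (b s 1 i (n - 1)) (e i (n - 1)))
               + (\<Sum>i=1..r. scale (b s 1 i n) (e i n))"

text \<open>Condition (1) for \<open>q\<^sub>s = k\<close> as vanishing of coefficients; see \<open>normal_form_iff_concentrated\<close>.\<close>

definition concentrated :: "nat \<Rightarrow> nat \<Rightarrow> bool" where
  "concentrated s k \<longleftrightarrow>
     b s 0 k 1 = 0 \<and> (\<forall>i\<in>{1..m}. \<forall>j\<le>n-1. i \<noteq> k \<longrightarrow> b s 0 i j = 0) \<and>
     b s 1 k 0 = 0 \<and> (\<forall>i\<in>{1..m}. \<forall>j\<le>n-2. i \<noteq> k \<longrightarrow> b s 1 i j = 0)"

lemma sum_concentrated:
  fixes c :: "nat \<Rightarrow> nat \<Rightarrow> complex"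
  assumes "k \<in> {1..m}"
    and "\<And>i j. i \<in> {1..m} \<Longrightarrow> j \<le> n - 1 \<Longrightarrow> \<not> (i = k \<and> j \<in> J) \<Longrightarrow> c i j = 0"
    and "J \<subseteq> {0..n-1}"
  shows "(\<Sum>i=1..m. \<Sum>j=0..n-1. scale (c i j) (e i j)) = (\<Sum>j\<in>J. scale (c k j) (e k j))"
proof -
  have "(\<Sum>i=1..m. \<Sum>j=0..n-1. scale (c i j) (e i j)) = (\<Sum>i\<in>{k}. \<Sum>j=0..n-1. scale (c i j) (e i j))"
    using assms by (intro sum.mono_neutral_right) (auto intro!: sum.neutral)
  also have "\<dots> = (\<Sum>j\<in>J. scale (c k j) (e k j))"
    using assms by (simp, intro sum.mono_neutral_right) auto
  finally show ?thesis .
qed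

text \<open>Both sides say which coordinates vanish. The coefficients at \<open>n\<close> are
  unrestricted, and so is that of \<open>e i (n - 1)\<close> in \<open>\<rho> (e s 1)\<close> for
  every \<open>i\<close>.\<close>

lemma normal_form_iff_concentrated:
  assumes s: "s \<in> {1..m}" and k: "k \<in> {1..m}"
  shows "normal_form s k \<longleftrightarrow> concentrated s k"
proof
  assume nf: "normal_form s k"
  have X: "b s 0 i j = 0" if "i \<in> {1..m}" "j \<le> n - 1" "i \<noteq> k \<or> j = 1" for i j
  proof -
    have "coord i j (\<rho> (e s 0)) = 0"
      using nf that k r_le n_ge unfolding normal_form_def
      by (auto simp: coord_linear coord_low coord_top intro!: sum.neutral)
    then show ?thesis using coord_rho_gen[OF s _ that(1,2)] by simp
  qed
  have Y: "b s 1 i j = 0" if "i \<in> {1..m}" "j \<le> n - 2" "i \<noteq> k \<or> j = 0" for i j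
  proof -
    have j: "j \<noteq> n - 1" "j \<le> n - 1" using that n_ge by auto
    have "coord i j (e k l) = 0" if "l \<in> {1..n-2}" for l
      using that \<open>i \<noteq> k \<or> j = 0\<close> \<open>i \<in> {1..m}\<close> k j n_ge by (auto simp: coord_low)
    then have "coord i j (\<rho> (e s 1)) = 0"
      using nf that(1) j r_le unfolding normal_form_def
      by (simp add: coord_linear coord_low coord_top)
    then show ?thesis using coord_rho_gen[OF s _ that(1)] that(2) by simp
  qed
  show "concentrated s k"
    unfolding concentrated_def using X Y k n_ge by auto
next
  assume c: "concentrated s k"
  have 0: "(\<Sum>i=1..m. \<Sum>j=0..n-1. scale (b s 0 i j) (e i j)) = (\<Sum>j\<in>insert 0 {2..n-1}. scale (b s 0 k j) (e k j))"
  proof (rule sum_concentrated[OF k])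
    fix i j assume ij: "i \<in> {1..m}" "j \<le> n - 1" "\<not> (i = k \<and> j \<in> insert 0 {2..n-1})"
    then show "b s 0 i j = 0"
      using c by (cases "i = k"; cases "j = 1") (auto simp: concentrated_def)
  qed (use n_ge in auto)
  \<comment> \<open>The unrestricted column \<open>n - 1\<close> is split off; what remains is
    supported on the summand \<open>k\<close>.\<close>
  define c' where "c' i j = (if j = n - 1 then 0 else b s 1 i j)" for i j
  have range_split: "{0..n-1} = insert (n - 1) {0..n-2}" using n_ge by auto
  have "(\<Sum>i=1..m. \<Sum>j=0..n-1. scale (b s 1 i j) (e i j))
    = (\<Sum>i=1..m. scale (b s 1 i (n-1)) (e i (n-1)) + (\<Sum>j=0..n-1. scale (c' i j) (e i j)))"
  proof (intro sum.cong refl)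
    fix i
    have "(\<Sum>j=0..n-1. scale (b s 1 i j) (e i j)) =
       scale (b s 1 i (n-1)) (e i (n-1)) + (\<Sum>j=0..n-2. scale (b s 1 i j) (e i j))"
      unfolding range_split using n_ge by (subst sum.insert) auto
    also have "(\<Sum>j=0..n-2. scale (b s 1 i j) (e i j)) = (\<Sum>j=0..n-2. scale (c' i j) (e i j))"
      using n_ge by (intro sum.cong) (auto simp: c'_def)
    also have "\<dots> = (\<Sum>j=0..n-1. scale (c' i j) (e i j))"
      unfolding range_split using n_ge by (subst sum.insert) (auto simp: c'_def)
    finally show "(\<Sum>j=0..n-1. scale (b s 1 i j) (e i j)) =
       scale (b s 1 i (n-1)) (e i (n-1)) + (\<Sum>j=0..n-1. scale (c' i j) (e i j))" .
  qed
  also have "\<dots> = (\<Sum>i=1..m. scale (b s 1 i (n-1)) (e i (n-1)))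
     + (\<Sum>i=1..m. \<Sum>j=0..n-1. scale (c' i j) (e i j))"
    by (simp add: sum.distrib)
  also have "(\<Sum>i=1..m. \<Sum>j=0..n-1. scale (c' i j) (e i j)) = (\<Sum>j\<in>{1..n-2}. scale (c' k j) (e k j))"
  proof (rule sum_concentrated[OF k])
    fix i j assume ij: "i \<in> {1..m}" "j \<le> n - 1" "\<not> (i = k \<and> j \<in> {1..n-2})"
    then show "c' i j = 0"
      using c by (cases "i = k"; cases "j = 0"; cases "j = n - 1") (auto simp: c'_def concentrated_def)
  qed auto
  also have "\<dots> = (\<Sum>j=1..n-2. scale (b s 1 k j) (e k j))"
    using n_ge by (intro sum.cong) (auto simp: c'_def)
  finally have 1: "(\<Sum>i=1..m. \<Sum>j=0..n-1. scale (b s 1 i j) (e i j))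
    = (\<Sum>i=1..m. scale (b s 1 i (n-1)) (e i (n-1))) + (\<Sum>j=1..n-2. scale (b s 1 k j) (e k j))" .
  show "normal_form s k"
    unfolding normal_form_def rho_gen[OF s insertI1] rho_gen[OF s insertI2[OF singletonI]] 0 1
    by (simp add: add_ac)
qed

lemma rho_br_on_gens_imp_automorphism:
  assumes "\<And>s p t u. s \<in> {1..m} \<Longrightarrow> p \<in> {1..m} \<Longrightarrow> t \<le> n \<Longrightarrow> u \<le> n \<Longrightarrow>
      \<rho> (br (e s t) (e p u)) = br (\<rho> (e s t)) (\<rho> (e p u))"
    and "surj \<rho>"
  shows "automorphism \<rho>"
proof -
  have "\<rho> (br x y) = br (\<rho> x) (\<rho> y)" for x y
    by (rule preserves_br_if_on_spanning_set[OF linear_rho span_e]) (use assms(1) in blast)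
  moreover have "bij \<rho>"
    using assms(2) linear_endo_surj_imp_inj[OF linear_rho] by (simp add: bij_def)
  ultimately show ?thesis
    using linear_rho by (simp add: automorphism_def)
qed

end

text \<open>Conditions (1), (2) and the nonvanishing part of (3) in index form. An automorphism
  satisfies them by \<open>automorphism_imp_concentrated\<close>; in the converse they are given.
  Both directions then meet in \<open>automorphism_iff\<close>.\<close>

locale concentrated_endomorphism = adapted_endomorphism scale br n m r Ns e B \<rho> b
  for scale :: "complex \<Rightarrow> 'a::ab_group_add \<Rightarrow> 'a" and br n m r Ns e B \<rho> b +
  fixes q :: "nat \<Rightarrow> nat"
  assumes q_bij: "bij_betw q {1..m} {1..m}"
    and conc: "s \<in> {1..m} \<Longrightarrow> concentrated s (q s)"
    and b_nonzero: "s \<in> {1..m} \<Longrightarrow> b s 0 (q s) 0 * b s 1 (q s) 1 \<noteq> 0"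
begin

lemma q_in: "s \<in> {1..m} \<Longrightarrow> q s \<in> {1..m}"
  by (rule bij_betw_apply[OF q_bij])

lemma q_eq_iff: "s \<in> {1..m} \<Longrightarrow> p \<in> {1..m} \<Longrightarrow> q s = q p \<longleftrightarrow> s = p"
  using bij_betw_imp_inj_on[OF q_bij] by (rule inj_on_eq_iff)

lemma coord_rho_0:
  assumes "s \<in> {1..m}" "i \<in> {1..m}" "j \<le> n - 1"
  shows "coord i j (\<rho> (e s 0)) = (if i = q s \<and> j \<noteq> 1 then b s 0 (q s) j else 0)"
  using conc[OF assms(1)] coord_rho_gen[OF assms(1) _ assms(2,3), of 0] assms
  by (cases "i = q s") (auto simp: concentrated_def)

text \<open>For \<open>t \<ge> 1\<close> the coordinate of \<open>\<rho> (e s t)\<close> at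
  \<open>e (q s) 0\<close> is zero, so bracketing with \<open>\<rho> (e s 0)\<close> shifts by one
  and multiplies by \<open>b s 0 (q s) 0\<close>. In the other summands
  \<open>\<rho> (e s 0)\<close> has coordinate 0 equal to zero, so the stray terms
  \<open>b s 1 i (n - 1)\<close> do not survive past \<open>t = 1\<close>.\<close>

lemma coord_rho:
  assumes s: "s \<in> {1..m}" and t: "1 \<le> t" "t \<le> n - 1"
    and i: "i \<in> {1..m}" and j: "j \<le> n - 1"
  shows "coord i j (\<rho> (e s t)) =
    (if i = q s then if t \<le> j then b s 0 (q s) 0 ^ (t - 1) * b s 1 (q s) (j + 1 - t) else 0
     else if t = 1 \<and> j = n - 1 then b s 1 i (n - 1) else 0)"
  using t j
proof (induction t arbitrary: j rule: nat_induct_at_least)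
  case base
  have "coord i j (\<rho> (e s 1)) = b s 1 i j"
    using coord_rho_gen[OF s _ i base(2), of 1] by simp
  moreover have "b s 1 i j = 0" if "i \<noteq> q s" "j \<noteq> n - 1"
    using that conc[OF s] i base(2) by (auto simp: concentrated_def)
  moreover have "b s 1 (q s) 0 = 0"
    using conc[OF s] by (auto simp: concentrated_def)
  ultimately show ?case by (cases "j = 0") auto
next
  case (Suc t)
  have t': "t \<le> n - 2" "t \<le> n - 1" using Suc.prems by auto
  have rho: "\<rho> (e s (Suc t)) = br (\<rho> (e s 0)) (\<rho> (e s t))"
    using rho_Suc[OF s Suc.hyps t'(1)] .
  show ?case
  proof (cases "j \<le> 1")
    case True
    then show ?thesis
      using rho coord_br_0_1[OF i True] Suc.hyps n_ge by auto
  next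
    case False
    then obtain j' where j': "j = Suc j'" "1 \<le> j'" "j' \<le> n - 2" "j' \<le> n - 1"
      using Suc.prems by (cases j) auto
    have "coord i j (\<rho> (e s (Suc t))) = coord i 0 (\<rho> (e s 0)) * coord i j' (\<rho> (e s t))
        - coord i 0 (\<rho> (e s t)) * coord i j' (\<rho> (e s 0))"
      using coord_br_Suc[OF i j'(2,3)] by (simp add: rho j'(1))
    also have "coord i 0 (\<rho> (e s t)) = 0"
      using Suc.IH[of 0] Suc.hyps t' n_ge by simp
    finally have "coord i j (\<rho> (e s (Suc t))) = coord i 0 (\<rho> (e s 0)) * coord i j' (\<rho> (e s t))"
      by simp
    then show ?thesis
      using Suc.IH[OF t'(2) j'(4)] coord_rho_0[OF s i, of 0] Suc.hyps j'
      by (auto simp: power_eq_if)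
  qed
qed

lemma coord_rho_off:
  assumes "s \<in> {1..m}" "t \<le> n - 1" "i \<in> {1..m}" "j \<le> n - 1" "i \<noteq> q s" "\<not> (t = 1 \<and> j = n - 1)"
  shows "coord i j (\<rho> (e s t)) = 0"
  using assms coord_rho[of s t i j] coord_rho_0[of s i j] by (cases "t = 0") auto

lemma coord_rho_1_eq_0:
  assumes "s \<in> {1..m}" "t \<le> n - 1" "i \<in> {1..m}" "t \<noteq> 1"
  shows "coord i 1 (\<rho> (e s t)) = 0"
  using assms coord_rho[of s t i 1] coord_rho_0[of s i 1] n_ge by (cases "t = 0") auto

section \<open>Brackets between images of basis vectors\<close>

lemma br_rho_diff_gen:
  assumes s: "s \<in> {1..m}" "p \<in> {1..m}" "s \<noteq> p" and t: "t \<le> n - 1" "u \<le> n - 1"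
  shows "br (\<rho> (e s t)) (\<rho> (e p u)) = (\<Sum>i=1..m. scale (\<omega> i (\<rho> (e s t)) (\<rho> (e p u))) (e i n))"
proof (rule br_central)
  fix i j assume ij: "i \<in> {1..m}" "1 \<le> j" "j \<le> n - 2"
  have "i \<noteq> q s \<or> i \<noteq> q p" using q_eq_iff s by auto
  then show "coord i 0 (\<rho> (e s t)) * coord i j (\<rho> (e p u)) = coord i 0 (\<rho> (e p u)) * coord i j (\<rho> (e s t))"
  proof
    assume "i \<noteq> q s"
    then have "coord i 0 (\<rho> (e s t)) = 0" "coord i j (\<rho> (e s t)) = 0"
      using ij n_ge by (auto intro!: coord_rho_off[OF s(1) t(1)])
    then show ?thesis by simp
  next
    assume "i \<noteq> q p"
    then have "coord i 0 (\<rho> (e p u)) = 0" "coord i j (\<rho> (e p u)) = 0"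
      using ij n_ge by (auto intro!: coord_rho_off[OF s(2) t(2)])
    then show ?thesis by simp
  qed
qed

text \<open>Below the top, an image has outside its own summand at most the coordinate
  \<open>n - 1\<close>, and only for \<open>t = 1\<close>. Under \<open>\<omega>\<close> this meets
  the coordinate 1 of the other image, which is zero unless \<open>u = 1\<close>.\<close>

lemma br_rho_diff:
  assumes s: "s \<in> {1..m}" "p \<in> {1..m}" "s \<noteq> p" and t: "t \<le> n - 1" "u \<le> n - 1"
    and tu: "\<not> (t = 1 \<and> u = 1)"
  shows "br (\<rho> (e s t)) (\<rho> (e p u)) = 0"
proof -
  have "\<omega> i (\<rho> (e s t)) (\<rho> (e p u)) = 0" if i: "i \<in> {1..m}" for i
  proof (rule \<omega>_eq_0)
    fix j assume j: "1 \<le> j" "j \<le> n - 1"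
    have "i \<noteq> q s \<or> i \<noteq> q p" using q_eq_iff s by auto
    then show "coord i j (\<rho> (e s t)) = 0 \<or> coord i (n - j) (\<rho> (e p u)) = 0"
    proof
      assume *: "i \<noteq> q s"
      show ?thesis
      proof (cases "t = 1 \<and> j = n - 1")
        case True
        then have "n - j = 1" using n_ge by auto
        then show ?thesis using coord_rho_1_eq_0[OF s(2) t(2) i] True tu by auto
      qed (use coord_rho_off[OF s(1) t(1) i j(2) *] in auto)
    next
      assume *: "i \<noteq> q p"
      show ?thesis
      proof (cases "u = 1 \<and> n - j = n - 1")
        case True
        then have "j = 1" using n_ge j by auto
        then show ?thesis using coord_rho_1_eq_0[OF s(1) t(1) i] True tu by auto
      next
        case False
        then show ?thesis using coord_rho_off[OF s(2) t(2) i _ *, of "n - j"] j by auto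
      qed
    qed
  qed
  then show ?thesis by (simp add: br_rho_diff_gen[OF s t])
qed

text \<open>One stray term survives in each of the two summands; the signs differ since
  \<open>j = 1\<close> is odd and \<open>j = n - 1\<close> is even.\<close>

lemma br_rho_1_1:
  assumes s: "s \<in> {1..m}" "p \<in> {1..m}" "s \<noteq> p"
  shows "br (\<rho> (e s 1)) (\<rho> (e p 1)) =
     scale (b s 1 (q p) (n - 1) * b p 1 (q p) 1) (e (q p) n)
     - scale (b s 1 (q s) 1 * b p 1 (q s) (n - 1)) (e (q s) n)"
proof -
  have n1: "(1::nat) \<le> n - 1" using n_ge by simp
  have range: "{1..n-1} = insert 1 (insert (n - 1) {2..n-2})" using n_ge by auto
  have even: "(-1::complex) ^ (n - 1) = 1" using odd_n by simp
  have \<omega>: "\<omega> i (\<rho> (e s 1)) (\<rho> (e p 1)) =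
     - (coord i 1 (\<rho> (e s 1)) * coord i (n - 1) (\<rho> (e p 1)))
     + coord i (n - 1) (\<rho> (e s 1)) * coord i 1 (\<rho> (e p 1))"
    if i: "i \<in> {1..m}" for i
  proof -
    have "coord i j (\<rho> (e s 1)) = 0 \<or> coord i (n - j) (\<rho> (e p 1)) = 0" if j: "j \<in> {2..n-2}" for j
    proof -
      have *: "j \<le> n - 1" "j \<noteq> n - 1" "n - j \<le> n - 1" "n - j \<noteq> n - 1" using j n_ge by auto
      have "i \<noteq> q s \<or> i \<noteq> q p" using q_eq_iff s by auto
      then show ?thesis
        using coord_rho_off[OF s(1) n1 i, of j] coord_rho_off[OF s(2) n1 i, of "n - j"] *
        by auto
    qed
    then have "(\<Sum>j\<in>{2..n-2}. (-1) ^ j * coord i j (\<rho> (e s 1)) * coord i (n - j) (\<rho> (e p 1))) = 0"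
      by (intro sum.neutral) auto
    moreover have "n - (n - 1) = 1" using n_ge by auto
    moreover have notin: "n - 1 \<notin> {2..n-2}" "1 \<notin> insert (n - 1) {2..n-2}" using n_ge by auto
    ultimately show ?thesis
      unfolding \<omega>_def range
      by (subst sum.insert[OF _ notin(2)], simp, subst sum.insert[OF _ notin(1)])
        (simp_all add: even del: One_nat_def)
  qed
  define F where "F i = scale (\<omega> i (\<rho> (e s 1)) (\<rho> (e p 1))) (e i n)" for i
  have "br (\<rho> (e s 1)) (\<rho> (e p 1)) = (\<Sum>i=1..m. F i)"
    unfolding F_def by (rule br_rho_diff_gen[OF s n1 n1])
  also have "\<dots> = (\<Sum>i\<in>{q s, q p}. F i)"
  proof (rule sum.mono_neutral_right)
    show "\<forall>i\<in>{1..m} - {q s, q p}. F i = 0"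
    proof
      fix i assume i: "i \<in> {1..m} - {q s, q p}"
      have "1 \<noteq> n - 1" using n_ge by auto
      then have "coord i 1 (\<rho> (e s 1)) = 0" "coord i 1 (\<rho> (e p 1)) = 0"
        using coord_rho_off[OF s(1) n1 _ n1, of i] coord_rho_off[OF s(2) n1 _ n1, of i] i by blast+
      then show "F i = 0"
        using \<omega>[of i] i by (simp add: F_def)
    qed
  qed (use q_in s in auto)
  also have "\<dots> = F (q s) + F (q p)" using q_eq_iff s by simp
  also have "F (q s) = - scale (b s 1 (q s) 1 * b p 1 (q s) (n - 1)) (e (q s) n)"
    unfolding F_def \<omega>[OF q_in[OF s(1)]] using s q_in q_eq_iff n_ge by (auto simp: coord_rho)
  also have "F (q p) = scale (b s 1 (q p) (n - 1) * b p 1 (q p) 1) (e (q p) n)"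
    unfolding F_def \<omega>[OF q_in[OF s(2)]] using s q_in q_eq_iff n_ge by (auto simp: coord_rho)
  finally show ?thesis by simp
qed

text \<open>Below the top, \<open>\<rho> (e s (n - 1))\<close> has only the coordinate at
  \<open>e (q s) (n - 1)\<close>; it pairs with the coordinate 1 of \<open>\<rho> (e s 0)\<close>,
  which (1) makes zero.\<close>

lemma br_rho_0_last:
  assumes s: "s \<in> {1..m}"
  shows "br (\<rho> (e s 0)) (\<rho> (e s (n - 1))) = 0"
proof (rule br_eq_0I)
  fix i j assume ij: "i \<in> {1..m}" "1 \<le> j" "j \<le> n - 2"
  have "\<not> n - 1 \<le> j" "j \<le> n - 1" using ij n_ge by auto
  then show "coord i 0 (\<rho> (e s 0)) * coord i j (\<rho> (e s (n - 1))) = coord i 0 (\<rho> (e s (n - 1))) * coord i j (\<rho> (e s 0))"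
    using n_ge s ij by (simp add: coord_rho)
next
  fix i j assume ij: "i \<in> {1..m}" "1 \<le> j" "j \<le> n - 1"
  then show "coord i j (\<rho> (e s 0)) = 0 \<or> coord i (n - j) (\<rho> (e s (n - 1))) = 0"
    using n_ge s by (auto simp: coord_rho coord_rho_0)
qed

text \<open>The left-hand side of condition (4); it vanishes trivially for even \<open>p\<close>.\<close>

definition conv :: "nat \<Rightarrow> nat \<Rightarrow> complex" where
  "conv s p = (\<Sum>j=1..p. (-1) ^ j * b s 1 (q s) j * b s 1 (q s) (p + 1 - j))"

text \<open>Outside \<open>q s\<close> the only possible coordinates sit at \<open>n - 1\<close>,
  which does not pair with itself, so a single summand contributes. For \<open>t + u > n\<close> the
  truncated \<open>n + 1 - t - u\<close> is 0 and \<open>conv\<close> is an empty sum.\<close>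

lemma br_rho_same:
  assumes s: "s \<in> {1..m}" and t: "1 \<le> t" "t \<le> n - 1" and u: "1 \<le> u" "u \<le> n - 1" and tu: "t + u \<ge> 3"
  shows "br (\<rho> (e s t)) (\<rho> (e s u)) =
     scale ((-1) ^ (t - 1) * b s 0 (q s) 0 ^ (t + u - 2) * conv s (n + 1 - t - u)) (e (q s) n)"
proof -
  have q: "q s \<in> {1..m}" using q_in[OF s] .
  let ?a = "b s 0 (q s) 0" and ?y = "b s 1 (q s)"
  define F where "F i = scale (\<omega> i (\<rho> (e s t)) (\<rho> (e s u))) (e i n)" for i
  have "br (\<rho> (e s t)) (\<rho> (e s u)) = (\<Sum>i=1..m. F i)"
    unfolding F_def using s t u by (intro br_central) (simp add: coord_rho)
  also have "\<dots> = (\<Sum>i\<in>{q s}. F i)"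
  proof (rule sum.mono_neutral_right)
    show "\<forall>i\<in>{1..m} - {q s}. F i = 0"
    proof
      fix i assume i: "i \<in> {1..m} - {q s}"
      have "\<omega> i (\<rho> (e s t)) (\<rho> (e s u)) = 0"
        using s t u tu i by (intro \<omega>_eq_0) (auto simp: coord_rho)
      then show "F i = 0" by (simp add: F_def)
    qed
  qed (use q in auto)
  also have "\<dots> = F (q s)" by simp
  finally have br: "br (\<rho> (e s t)) (\<rho> (e s u)) = F (q s)" .
  have "\<omega> (q s) (\<rho> (e s t)) (\<rho> (e s u)) =
      (\<Sum>j=1..n-1. if t \<le> j \<and> u \<le> n - j then (-1) ^ j * (?a ^ (t - 1) * ?y (j + 1 - t)) * (?a ^ (u - 1) * ?y (n - j + 1 - u)) else 0)"
    unfolding \<omega>_def using s t u q by (intro sum.cong refl) (auto simp: coord_rho)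
  also have "\<dots> = (\<Sum>j\<in>{t..n-u}. (-1) ^ j * (?a ^ (t - 1) * ?y (j + 1 - t)) * (?a ^ (u - 1) * ?y (n - j + 1 - u)))"
    using t u by (intro sum.mono_neutral_cong_right) auto
  \<comment> \<open>The substitution \<open>j\<close> to \<open>j + 1 - t\<close> brings the first
    factor back to \<open>b s 1 (q s) j\<close>; the factor \<open>(-1) ^ (t - 1)\<close> comes from
    it.\<close>
  also have "\<dots> = (\<Sum>j=1..n+1-t-u. (-1) ^ (t - 1) * ?a ^ (t + u - 2) * ((-1) ^ j * ?y j * ?y (n + 1 - t - u + 1 - j)))"
  proof (rule sum.reindex_bij_witness[of _ "\<lambda>j. j + t - 1" "\<lambda>j. j + 1 - t"])
    fix j assume j: "j \<in> {t..n-u}"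
    have "t + u - 2 = (t - 1) + (u - 1)" using t u by simp
    then have "?a ^ (t + u - 2) = ?a ^ (t - 1) * ?a ^ (u - 1)" by (simp only: power_add)
    moreover have "j = (t - 1) + (j + 1 - t)" using j t by auto
    then have "(-1::complex) ^ j = (-1) ^ (t - 1) * (-1) ^ (j + 1 - t)" by (metis power_add)
    moreover have "n + 1 - t - u + 1 - (j + 1 - t) = n - j + 1 - u" using j t u by auto
    ultimately show "(-1) ^ (t - 1) * ?a ^ (t + u - 2) * ((-1) ^ (j + 1 - t) * ?y (j + 1 - t) * ?y (n + 1 - t - u + 1 - (j + 1 - t)))
        = (-1) ^ j * (?a ^ (t - 1) * ?y (j + 1 - t)) * (?a ^ (u - 1) * ?y (n - j + 1 - u))"
      by (simp add: mult_ac)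
  qed (use t u in auto)
  finally show ?thesis
    unfolding br conv_def F_def sum_distrib_left by simp
qed

text \<open>The \<open>k\<^sub>i\<close> of condition (5).\<close>

definition kval :: "nat \<Rightarrow> complex" where
  "kval i = b i 0 (q i) 0 ^ (n - 2) * b i 1 (q i) 1 ^ 2"

lemma br_rho_1_last:
  assumes s: "s \<in> {1..m}"
  shows "br (\<rho> (e s 1)) (\<rho> (e s (n - 1))) = - scale (kval s) (e (q s) n)"
proof -
  have "n + 1 - 1 - (n - 1) = 1" "1 + (n - 1) - 2 = n - 2" using n_ge by auto
  then show ?thesis
    using br_rho_same[OF s, of 1 "n - 1"] n_ge
    by (simp add: conv_def kval_def power2_eq_square)
qed

lemma rho_top_le_r: "s \<in> {1..r} \<Longrightarrow> \<rho> (e s n) = scale (kval s) (e (q s) n)"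
  using rho_top[of s] br_rho_1_last[of s] r_le by auto

text \<open>Triangularity: the image contains the top vectors since \<open>kval s\<close> is
  nonzero; then, for \<open>l\<close> descending from \<open>n - 1\<close>, \<open>e (q s) l\<close>
  is the leading term of \<open>\<rho> (e s l)\<close>, and last \<open>e (q s) 0\<close> that of
  \<open>\<rho> (e s 0)\<close>.\<close>

lemma surj_rho_if_top:
  assumes top: "\<And>s. s \<in> {1..m} \<Longrightarrow> \<rho> (e s n) = scale (kval s) (e (q s) n)"
  shows "surj \<rho>"
proof -
  define W where "W = range \<rho>"
  have W: "subspace W"
    unfolding W_def by (rule rho.subspace_image) (rule subspace_UNIV)
  have W_rho: "\<rho> x \<in> W" for x by (simp add: W_def)
  have q_surj: "\<exists>s\<in>{1..m}. k = q s" if "k \<in> {1..m}" for k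
    using bij_betw_imp_surj_on[OF q_bij] that by blast
  have e_top: "e k n \<in> W" if k: "k \<in> {1..m}" for k
  proof -
    obtain s where s: "s \<in> {1..m}" "k = q s" using q_surj[OF k] by blast
    have "kval s \<noteq> 0" using b_nonzero[OF s(1)] by (simp add: kval_def)
    moreover have "scale (inverse (kval s)) (\<rho> (e s n)) \<in> W"
      using W W_rho by (rule subspace_scale)
    ultimately show ?thesis using top[OF s(1)] s(2) by simp
  qed
  have e_top_r: "e k n \<in> W" if "k \<in> {1..r}" for k
    using that r_le by (intro e_top) auto
  have e_pos: "e k l \<in> W" if "k \<in> {1..m}" "1 \<le> l" "l \<le> n - 1" for k l
    using that
  proof (induction "n - l" arbitrary: k l rule: less_induct)
    case less
    obtain s where s: "s \<in> {1..m}" "k = q s" using q_surj[OF less.prems(1)] by blast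
    show ?case
    proof (rule e_mem_subspace_if_leading[OF W W_rho[of "e s l"] less.prems(1,3) _ _ e_top_r])
      show "coord k l (\<rho> (e s l)) \<noteq> 0"
        using b_nonzero[OF s(1)] coord_rho[OF s(1) less.prems(2,3,1,3)] s(2) by simp
    next
      fix i j
      assume ij: "i \<in> {1..m}" "j \<le> n - 1" "(i, j) \<noteq> (k, l)" "coord i j (\<rho> (e s l)) \<noteq> 0"
      \<comment> \<open>The stray terms of \<open>\<rho> (e s 1)\<close> sit at
        \<open>n - 1 > 1\<close>, so the induction covers them too.\<close>
      then have "l < j"
        using coord_rho[OF s(1) less.prems(2,3) ij(1,2)] s(2) n_ge
        by (auto split: if_splits)
      then show "e i j \<in> W" using less.hyps[of j i] ij less.prems by auto
    qed
  qed
  have "e k 0 \<in> W" if k: "k \<in> {1..m}" for k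
  proof -
    obtain s where s: "s \<in> {1..m}" "k = q s" using q_surj[OF k] by blast
    show ?thesis
    proof (rule e_mem_subspace_if_leading[OF W W_rho[of "e s 0"] k _ _ _ e_top_r])
      show "coord k 0 (\<rho> (e s 0)) \<noteq> 0"
        using b_nonzero[OF s(1)] coord_rho_0[OF s(1) k, of 0] s(2) by simp
    next
      fix i j
      assume ij: "i \<in> {1..m}" "j \<le> n - 1" "(i, j) \<noteq> (k, 0)" "coord i j (\<rho> (e s 0)) \<noteq> 0"
      then have "1 \<le> j"
        using coord_rho_0[OF s(1) ij(1,2)] s(2) by (cases j) (auto split: if_splits)
      then show "e i j \<in> W" using e_pos ij by blast
    qed simp
  qed
  then have low: "e k l \<in> W" if "k \<in> {1..m}" "l \<le> n - 1" for k l
    using that e_pos[OF that(1) _ that(2)] by (cases l) simp_all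
  have "x \<in> W" for x
    by (rule mem_subspace_if_coords[OF W low e_top_r])
  then have "W = UNIV" by blast
  then show ?thesis by (simp only: W_def)
qed

text \<open>All brackets of images are now explicit. Those not tied to the three conditions agree
  automatically: \<open>\<rho> (e s 0)\<close> acts by the recursion for \<open>\<rho>\<close>, and
  different summands interact only through \<open>br_rho_1_1\<close>.\<close>

lemma automorphism_iff:
  "automorphism \<rho> \<longleftrightarrow>
     (\<forall>s\<in>{1..m}. \<forall>p\<in>{1..m}. scale (b s 1 (q s) 1 * b p 1 (q s) (n - 1)) (e (q s) n)
          = scale (b s 1 (q p) (n - 1) * b p 1 (q p) 1) (e (q p) n)) \<and>
     (\<forall>s\<in>{1..m}. \<forall>p\<in>{3..n-2}. odd p \<longrightarrow> conv s p = 0) \<and>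
     (\<forall>s\<in>{1..m}. \<rho> (e s n) = scale (kval s) (e (q s) n))" (is "_ \<longleftrightarrow> ?C3 \<and> ?C4 \<and> ?C5")
proof
  assume aut: "automorphism \<rho>"
  then have hom: "br (\<rho> x) (\<rho> y) = \<rho> (br x y)" for x y
    by (simp add: automorphism_def)
  have ?C3
  proof (intro ballI)
    fix s p assume s: "s \<in> {1..m}" and p: "p \<in> {1..m}"
    show "scale (b s 1 (q s) 1 * b p 1 (q s) (n - 1)) (e (q s) n)
          = scale (b s 1 (q p) (n - 1) * b p 1 (q p) 1) (e (q p) n)"
    proof (cases "s = p")
      case False
      have "br (\<rho> (e s 1)) (\<rho> (e p 1)) = 0"
        using br_distinct[OF s p False, of 1 1] n_ge by (simp add: hom rho.zero)
      then show ?thesis using br_rho_1_1[OF s p False] by simp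
    qed (simp add: mult.commute)
  qed
  moreover have ?C4
  proof (intro ballI impI)
    fix s p assume s: "s \<in> {1..m}" and p: "p \<in> {3..n-2}" "odd p"
    \<comment> \<open>The index \<open>n - p\<close> makes \<open>br_rho_same\<close> yield exactly
      \<open>conv s p\<close>; as \<open>p \<noteq> 1\<close>, it does not add up with 1 to
      \<open>n\<close>.\<close>
    have "br (e s 1) (e s (n - p)) = 0"
      using p n_ge by (intro br_same(3)[OF s]) auto
    then have "br (\<rho> (e s 1)) (\<rho> (e s (n - p))) = 0"
      by (simp add: hom rho.zero)
    moreover have "n + 1 - 1 - (n - p) = p" using p by auto
    ultimately have "scale ((-1) ^ (1 - 1) * b s 0 (q s) 0 ^ (1 + (n - p) - 2) * conv s p) (e (q s) n) = 0"
      using br_rho_same[OF s, of 1 "n - p"] p n_ge by (auto simp del: scale_eq_0_iff)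
    then show "conv s p = 0"
      using e_top_nonzero[OF q_in[OF s]] b_nonzero[OF s] by simp
  qed
  moreover have ?C5
  proof
    fix s assume s: "s \<in> {1..m}"
    have "br (e s 1) (e s (n - 1)) = - e s n"
      using br_same(2)[OF s, of 1] n_ge by simp
    then have "br (\<rho> (e s 1)) (\<rho> (e s (n - 1))) = - \<rho> (e s n)"
      by (simp add: hom rho.neg)
    then show "\<rho> (e s n) = scale (kval s) (e (q s) n)"
      using br_rho_1_last[OF s] by simp
  qed
  ultimately show "?C3 \<and> ?C4 \<and> ?C5" by blast
next
  assume C: "?C3 \<and> ?C4 \<and> ?C5"
  have top: "\<rho> (e s n) = scale (kval s) (e (q s) n)" if "s \<in> {1..m}" for s
    using C that by blast
  \<comment> \<open>In \<open>br_rho_same\<close> the value \<open>p = 1\<close> belongs to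
    \<open>t + u = n\<close>, the one nonzero pairing. Even \<open>p\<close>, including the empty
    sum, vanish by reflection; the other odd ones are (4).\<close>
  have conv0: "conv s p = 0" if s: "s \<in> {1..m}" and p: "p \<noteq> 1" "p \<le> n - 2" for s p
  proof (cases "odd p")
    case True
    then obtain l where "p = 2 * l + 1" by (elim oddE)
    then have "p \<in> {3..n-2}" using p by auto
    then show ?thesis using C s True by blast
  qed (use alternating_convolution_even_eq_0 in \<open>auto simp: conv_def\<close>)
  have flip: "\<rho> (br x y) = br (\<rho> x) (\<rho> y)" if "\<rho> (br y x) = br (\<rho> y) (\<rho> x)" for x y
    using that br_antisym[of x y] br_antisym[of "\<rho> x" "\<rho> y"] by (simp add: rho.neg)
  have hom_top: "\<rho> (br (e s n) x) = br (\<rho> (e s n)) (\<rho> x)" if "s \<in> {1..m}" for s x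
    using that q_in by (simp add: top rho.zero br_scale_left)
  have hom_0: "\<rho> (br (e s 0) (e s u)) = br (\<rho> (e s 0)) (\<rho> (e s u))" if s: "s \<in> {1..m}" and u: "u \<le> n - 1" for s u
  proof -
    consider "u = 0" | "1 \<le> u" "u \<le> n - 2" | "u = n - 1" using u by linarith
    then show ?thesis
    proof cases
      case 2
      then show ?thesis using br_same(1)[OF s 2] rho_Suc[OF s 2] by simp
    next
      case 3
      then show ?thesis using br_same(4)[OF s] br_rho_0_last[OF s] by (simp add: rho.zero)
    qed (simp add: br_self rho.zero)
  qed
  have hom_pos: "\<rho> (br (e s t) (e s u)) = br (\<rho> (e s t)) (\<rho> (e s u))"
    if s: "s \<in> {1..m}" and t: "1 \<le> t" "t \<le> n - 1" and u: "1 \<le> u" "u \<le> n - 1" for s t u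
  proof -
    consider "t = 1" "u = 1" | "t + u \<ge> 3" "t + u = n" | "t + u \<ge> 3" "t + u \<noteq> n"
      using t u n_ge by linarith
    then show ?thesis
    proof cases
      case 2
      then have "u = n - t" "n + 1 - t - u = 1" by auto
      then have "br (e s t) (e s u) = scale ((-1) ^ t) (e s n)"
        using br_same(2)[OF s t] by simp
      \<comment> \<open>This sign is absorbed by \<open>conv s 1\<close>, which is minus a
        square.\<close>
      moreover have "(-1 :: complex) ^ t = - ((-1) ^ (t - 1))"
        using t by (cases t) auto
      ultimately show ?thesis
        using br_rho_same[OF s t u 2(1)] top[OF s] \<open>n + 1 - t - u = 1\<close> 2(2)
        by (simp add: rho.scale rho.neg conv_def kval_def power2_eq_square mult_ac)
    next
      case 3
      then have "n + 1 - t - u \<noteq> 1" "n + 1 - t - u \<le> n - 2" by auto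
      then show ?thesis
        using br_rho_same[OF s t u 3(1)] conv0[OF s] br_same(3)[OF s t(1) u(1) _ _ 3(2)] t u
        by (simp add: rho.zero)
    qed (simp add: br_self rho.zero)
  qed
  have hom_diff: "\<rho> (br (e s t) (e p u)) = br (\<rho> (e s t)) (\<rho> (e p u))"
    if s: "s \<in> {1..m}" "p \<in> {1..m}" "s \<noteq> p" and t: "t \<le> n - 1" "u \<le> n - 1" for s p t u
  proof -
    have "br (\<rho> (e s t)) (\<rho> (e p u)) = 0"
    proof (cases "t = 1 \<and> u = 1")
      case True
      then show ?thesis using br_rho_1_1[OF s] C s by simp
    qed (use br_rho_diff[OF s t] in blast)
    then show ?thesis using br_distinct[OF s] t by (simp add: rho.zero)
  qed
  show "automorphism \<rho>"
  proof (rule rho_br_on_gens_imp_automorphism)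
    fix s p t u
    assume s: "s \<in> {1..m}" and p: "p \<in> {1..m}" and t: "t \<le> n" and u: "u \<le> n"
    consider "t = n" | "u = n" | "t \<le> n - 1" "u \<le> n - 1" "s \<noteq> p" | "s = p" "t = 0" "u \<le> n - 1"
      | "s = p" "u = 0" "t \<le> n - 1" | "s = p" "1 \<le> t" "t \<le> n - 1" "1 \<le> u" "u \<le> n - 1"
      using t u by linarith
    then show "\<rho> (br (e s t) (e p u)) = br (\<rho> (e s t)) (\<rho> (e p u))"
    proof cases
      case 1
      then show ?thesis using hom_top[OF s] by simp
    next
      case 2
      then show ?thesis using hom_top[OF p] flip by simp
    next
      case 3
      then show ?thesis using hom_diff s p by blast
    next
      case 4
      then show ?thesis using hom_0 s by blast
    next
      case 5
      then show ?thesis using hom_0 s flip by blast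
    next
      case 6
      then show ?thesis using hom_pos s by blast
    qed
  qed (rule surj_rho_if_top[OF top])
qed

end

section \<open>The shape of an automorphism\<close>

context adapted_endomorphism
begin

definition minor :: "nat \<Rightarrow> nat \<Rightarrow> complex" where
  "minor s i = b s 0 i 0 * b s 1 i 1 - b s 1 i 0 * b s 0 i 1"

text \<open>No shape is assumed here. The step to \<open>t = 2\<close> produces the minor; from then
  on the coordinate 0 vanishes, so each bracket with \<open>\<rho> (e s 0)\<close> shifts the lowest
  coordinate and multiplies it by \<open>b s 0 i 0\<close>.\<close>

lemma coord_rho_leading:
  assumes s: "s \<in> {1..m}" and t: "2 \<le> t" "t \<le> n - 1" and i: "i \<in> {1..m}"
  shows "coord i t (\<rho> (e s t)) = b s 0 i 0 ^ (t - 2) * minor s i"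
    and "j < t \<Longrightarrow> coord i j (\<rho> (e s t)) = 0"
proof -
  have "coord i t (\<rho> (e s t)) = b s 0 i 0 ^ (t - 2) * minor s i \<and> (\<forall>j<t. coord i j (\<rho> (e s t)) = 0)"
    using t
  proof (induction t rule: nat_induct_at_least)
    case base
    have rho: "\<rho> (e s (Suc 1)) = br (\<rho> (e s 0)) (\<rho> (e s 1))"
      using n_ge by (intro rho_Suc[OF s]) auto
    have "coord i (Suc 1) (\<rho> (e s (Suc 1))) = minor s i"
      unfolding rho using n_ge s i
      by (subst coord_br_Suc) (auto simp: coord_rho_gen minor_def)
    then show ?case
      using coord_br_0_1[OF i] rho by (auto simp: numeral_2_eq_2)
  next
    case (Suc t)
    have t: "1 \<le> t" "t \<le> n - 2" using Suc by auto
    have rho: "\<rho> (e s (Suc t)) = br (\<rho> (e s 0)) (\<rho> (e s t))"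
      by (rule rho_Suc[OF s t])
    have IH: "coord i t (\<rho> (e s t)) = b s 0 i 0 ^ (t - 2) * minor s i" "\<forall>j<t. coord i j (\<rho> (e s t)) = 0"
      using Suc by auto
    have X: "coord i 0 (\<rho> (e s 0)) = b s 0 i 0"
      using s i by (simp add: coord_rho_gen)
    have step: "coord i (Suc j) (\<rho> (e s (Suc t))) = b s 0 i 0 * coord i j (\<rho> (e s t))"
      if "1 \<le> j" "j \<le> t" for j
    proof -
      have "coord i 0 (\<rho> (e s t)) = 0" using IH(2) t by auto
      then show ?thesis unfolding rho using coord_br_Suc[OF i that(1)] that t by (simp add: X)
    qed
    have "coord i j (\<rho> (e s (Suc t))) = 0" if "j < Suc t" for j
    proof (cases "j \<le> 1")
      case True
      then show ?thesis unfolding rho by (rule coord_br_0_1[OF i])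
    next
      case False
      then show ?thesis using step[of "j - 1"] IH(2) that by auto
    qed
    moreover have "Suc t - 2 = Suc (t - 2)" using Suc.hyps by auto
    ultimately show ?case using step[of t] IH(1) t by simp
  qed
  then show "coord i t (\<rho> (e s t)) = b s 0 i 0 ^ (t - 2) * minor s i"
    and "j < t \<Longrightarrow> coord i j (\<rho> (e s t)) = 0" by blast+
qed

text \<open>Vanishing brackets are exploited below the top as proportional coordinates, and at the
  top through \<open>\<omega>\<close>, once all summands but one are known to contribute
  nothing.\<close>

lemma automorphism_imp_concentrated:
  assumes aut: "automorphism \<rho>"
  obtains q where "concentrated_endomorphism scale br n m r Ns e B \<rho> b q"
proof -
  have inj: "inj \<rho>" and hom: "br (\<rho> x) (\<rho> y) = \<rho> (br x y)" for x y
    using aut by (simp_all add: automorphism_def bij_def)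
  have n1: "2 \<le> n - 1" "n - 1 \<le> n - 1" "1 \<le> n - 1" "(1::nat) \<le> n - 2" using n_ge by auto
  \<comment> \<open>Otherwise \<open>\<rho> (e s (n - 1))\<close> is a combination of top vectors,
    hence central, whereas \<open>e s 1\<close> and \<open>e s (n - 1)\<close> have nonzero bracket
    and \<open>\<rho>\<close> is injective.\<close>
  have ex: "\<exists>i\<in>{1..m}. b s 0 i 0 ^ (n - 3) * minor s i \<noteq> 0" if s: "s \<in> {1..m}" for s
  proof (rule ccontr)
    assume contr: "\<not> ?thesis"
    have "n - 1 - 2 = n - 3" by simp
    then have c: "coord i j (\<rho> (e s (n - 1))) = 0" if "i \<in> {1..m}" "j \<le> n - 1" for i j
      using coord_rho_leading[OF s n1(1,2) that(1)] contr that
      by (cases "j = n - 1") auto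
    have "br (\<rho> (e s 1)) (\<rho> (e s (n - 1))) = 0"
      using n_ge by (intro br_eq_0I) (auto simp: c simp del: One_nat_def)
    then have "\<rho> (br (e s 1) (e s (n - 1))) = \<rho> 0" by (simp add: hom rho.zero)
    then have "br (e s 1) (e s (n - 1)) = 0" by (rule injD[OF inj])
    then show False using br_same(2)[OF s, of 1] n1 e_top_nonzero[OF s] by simp
  qed
  define q where "q s = (SOME i. i \<in> {1..m} \<and> b s 0 i 0 ^ (n - 3) * minor s i \<noteq> 0)" for s
  have q: "q s \<in> {1..m}" "b s 0 (q s) 0 \<noteq> 0" "minor s (q s) \<noteq> 0" if s: "s \<in> {1..m}" for s
  proof -
    have "q s \<in> {1..m} \<and> b s 0 (q s) 0 ^ (n - 3) * minor s (q s) \<noteq> 0"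
      unfolding q_def by (rule someI_ex) (use ex[OF s] in blast)
    \<comment> \<open>A positive exponent lets the nonzero power detect
      \<open>b s 0 (q s) 0 \<noteq> 0\<close>.\<close>
    moreover have "n - 3 \<noteq> 0" using n_ge by auto
    ultimately show "q s \<in> {1..m}" "b s 0 (q s) 0 \<noteq> 0" "minor s (q s) \<noteq> 0" by auto
  qed
  have Y0: "b s 1 (q s) 0 = 0" if s: "s \<in> {1..m}" for s
  proof -
    \<comment> \<open>The coordinate 3 of the image of this bracket is \<open>b s 1 (q s) 0\<close>
      times the minor. That \<open>e s 1\<close> and \<open>e s 2\<close> commute relies on
      \<open>n \<noteq> 3\<close>.\<close>
    have "br (e s 1) (e s 2) = 0" using n_ge by (intro br_same(3)[OF s]) auto
    then have "br (\<rho> (e s 1)) (\<rho> (e s 2)) = 0" by (simp add: hom rho.zero)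
    then have "coord (q s) 0 (\<rho> (e s 1)) * coord (q s) 2 (\<rho> (e s 2))
        = coord (q s) 0 (\<rho> (e s 2)) * coord (q s) 2 (\<rho> (e s 1))"
      using n_ge by (intro coord_of_br_zero q[OF s]) auto
    moreover have "coord (q s) 0 (\<rho> (e s 2)) = 0" "coord (q s) 2 (\<rho> (e s 2)) = minor s (q s)"
      using coord_rho_leading[OF s _ n1(1) q(1)[OF s]] by auto
    ultimately show ?thesis using q[OF s] s by (simp add: coord_rho_gen)
  qed
  have Y1: "b s 1 (q s) 1 \<noteq> 0" if s: "s \<in> {1..m}" for s
    using q(3)[OF s] Y0[OF s] by (auto simp: minor_def)
  have comm: "br (\<rho> (e s t)) (\<rho> (e p u)) = 0"
    if "s \<in> {1..m}" "p \<in> {1..m}" "s \<noteq> p" "t \<le> n" "u \<le> n" for s p t u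
    using br_distinct[OF that] by (simp add: hom rho.zero)
  have comm_coord: "b s u i 0 * b p v i j = b p v i 0 * b s u i j"
    if "s \<in> {1..m}" "p \<in> {1..m}" "s \<noteq> p" "u \<in> {0, 1}" "v \<in> {0, 1}" "i \<in> {1..m}" "1 \<le> j" "j \<le> n - 2"
    for s p u v i j
  proof -
    have "br (\<rho> (e s u)) (\<rho> (e p v)) = 0"
      using that n_ge by (intro comm) auto
    from coord_of_br_zero[OF this that(6-8)] show ?thesis
      using that by (simp add: coord_rho_gen)
  qed
  \<comment> \<open>At \<open>q s\<close> the image \<open>\<rho> (e s 1)\<close> has coordinate 0
    zero and coordinate 1 nonzero; commuting with it kills the coordinate 0, and commuting with
    \<open>\<rho> (e s 0)\<close> then kills the coordinate 1.\<close>
  have other01: "b p v (q s) 0 = 0" "b p v (q s) 1 = 0"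
    if s: "s \<in> {1..m}" "p \<in> {1..m}" "s \<noteq> p" and v: "v \<in> {0, 1}" for s p v
  proof -
    show 0: "b p v (q s) 0 = 0"
      using comm_coord[OF s _ v q(1)[OF s(1)] le_refl n1(4), of 1] Y0[OF s(1)] Y1[OF s(1)] by simp
    show "b p v (q s) 1 = 0"
      using comm_coord[OF s _ v q(1)[OF s(1)] le_refl n1(4), of 0] q(2)[OF s(1)] 0 by simp
  qed
  have inj_q: "inj_on q {1..m}"
  proof (rule inj_onI, rule ccontr)
    fix s p assume "s \<in> {1..m}" "p \<in> {1..m}" "q s = q p" "s \<noteq> p"
    then show False using other01(1)[of s p 0] q(2)[of p] by simp
  qed
  have bij_q: "bij_betw q {1..m} {1..m}"
    using inj_q q(1) by (intro bij_betw_imageI endo_inj_surj) auto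
  have ex_other: "\<exists>p\<in>{1..m}. s \<noteq> p \<and> i = q p" if "i \<in> {1..m}" "i \<noteq> q s" for s i
  proof -
    have "i \<in> q ` {1..m}" using bij_betw_imp_surj_on[OF bij_q] that(1) by simp
    then obtain p where p: "p \<in> {1..m}" "i = q p" by auto
    then show ?thesis using that(2) by (intro bexI[of _ p]) auto
  qed
  \<comment> \<open>As \<open>q\<close> is onto, \<open>i\<close> belongs to another index
    \<open>p\<close>, and commuting with \<open>\<rho> (e p 0)\<close> kills the coordinates up to
    \<open>n - 2\<close>. The coordinate \<open>n - 1\<close> escapes because \<open>e i 0\<close>
    and \<open>e i (n - 1)\<close> commute.\<close>
  have zero_low: "b s v i j = 0"
    if s: "s \<in> {1..m}" and v: "v \<in> {0, 1}" and i: "i \<in> {1..m}" "i \<noteq> q s" and j: "j \<le> n - 2" for s v i j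
  proof -
    obtain p where p: "p \<in> {1..m}" "s \<noteq> p" "i = q p" using ex_other[OF i] by blast
    show ?thesis
    proof (cases "j = 0")
      case True
      then show ?thesis using other01(1)[OF p(1) s _ v] p by auto
    next
      case False
      then show ?thesis
        using comm_coord[OF p(1) s _ _ v i(1) _ j, of 0] other01(1)[OF p(1) s _ v] q(2)[OF p(1)] p by auto
    qed
  qed
  \<comment> \<open>Only the leading coordinate of \<open>\<rho> (e s (n - 1))\<close> enters
    \<open>\<omega>\<close>, paired with the coordinate 1 of \<open>\<rho> (e s 0)\<close>. The
    other summands drop out by \<open>zero_low\<close>, so a single nonzero top vector remains and
    dependence among top vectors does no harm.\<close>
  have X1: "b s 0 (q s) 1 = 0" if s: "s \<in> {1..m}" for s
  proof -
    let ?x = "\<rho> (e s 0)" and ?y = "\<rho> (e s (n - 1))"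
    have br0: "br ?x ?y = 0"
      using br_same(4)[OF s] by (simp add: hom rho.zero)
    have n3: "n - 1 - 2 = n - 3" by simp
    have lead: "coord i (n - 1) ?y = b s 0 i 0 ^ (n - 3) * minor s i"
      "\<And>j. j < n - 1 \<Longrightarrow> coord i j ?y = 0" if "i \<in> {1..m}" for i
      using coord_rho_leading[OF s n1(1,2) that, unfolded n3] by simp_all
    have om: "\<omega> i ?x ?y = - (b s 0 i 1 * (b s 0 i 0 ^ (n - 3) * minor s i))" if i: "i \<in> {1..m}" for i
    proof -
      have "\<omega> i ?x ?y = (\<Sum>j\<in>{1}. (-1) ^ j * coord i j ?x * coord i (n - j) ?y)"
        unfolding \<omega>_def using n_ge lead(2)[OF i] by (intro sum.mono_neutral_right) auto
      then show ?thesis using lead(1)[OF i] coord_rho_gen[OF s _ i n1(3), of 0] by simp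
    qed
    have "0 = (\<Sum>i=1..m. scale (\<omega> i ?x ?y) (e i n))"
      unfolding br0[symmetric] by (rule br_central) (use coord_of_br_zero[OF br0] in blast)
    also have "\<dots> = (\<Sum>i\<in>{q s}. scale (\<omega> i ?x ?y) (e i n))"
    proof (rule sum.mono_neutral_right)
      have "b s 0 i 1 = 0" if "i \<in> {1..m}" "i \<noteq> q s" for i
        using zero_low[OF s _ that n1(4)] by simp
      then show "\<forall>i\<in>{1..m} - {q s}. scale (\<omega> i ?x ?y) (e i n) = 0"
        using om by auto
    qed (use q[OF s] in auto)
    also have "\<dots> = scale (- (b s 0 (q s) 1 * (b s 0 (q s) 0 ^ (n - 3) * minor s (q s)))) (e (q s) n)"
      using om[OF q(1)[OF s]] by simp
    finally show ?thesis
      using q[OF s] e_top_nonzero[OF q(1)[OF s]] by auto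
  qed
  \<comment> \<open>This uses that \<open>\<rho> (e p 1)\<close> and \<open>\<rho> (e s 0)\<close>
    commute, where \<open>i = q p\<close>. Stray coordinates of the former meet the coordinate 1 of
    the latter, zero by \<open>X1\<close> and \<open>zero_low\<close>, so only the summand
    \<open>q p\<close> contributes.\<close>
  have Xlast: "b s 0 i (n - 1) = 0" if s: "s \<in> {1..m}" and i: "i \<in> {1..m}" "i \<noteq> q s" for s i
  proof -
    obtain p where p: "p \<in> {1..m}" "s \<noteq> p" "i = q p" using ex_other[OF i] by blast
    let ?x = "\<rho> (e s 0)" and ?y = "\<rho> (e p 1)"
    have br0: "br ?y ?x = 0" using p s n_ge by (intro comm) auto
    have x1: "coord k 1 ?x = 0" if "k \<in> {1..m}" for k
      using zero_low[OF s _ that _ n1(4), of 0] X1[OF s] coord_rho_gen[OF s _ that n1(3), of 0] by (cases "k = q s") auto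
    have zero: "scale (\<omega> k ?y ?x) (e k n) = 0" if k: "k \<in> {1..m} - {q p}" for k
    proof -
      have "\<omega> k ?y ?x = 0"
      proof (rule \<omega>_eq_0)
        fix j assume j: "1 \<le> j" "j \<le> n - 1"
        show "coord k j ?y = 0 \<or> coord k (n - j) ?x = 0"
        proof (cases "j = n - 1")
          case True
          then have "n - j = 1" using n_ge by auto
          then show ?thesis using x1 k by auto
        next
          case False
          then have "j \<le> n - 2" using j by auto
          then show ?thesis
            using zero_low[OF p(1) _ _ _ \<open>j \<le> n - 2\<close>, of 1 k] coord_rho_gen[OF p(1) _ _ j(2), of 1 k] k by auto
        qed
      qed
      then show ?thesis by simp
    qed
    have "\<omega> i ?y ?x = (\<Sum>j\<in>{1}. (-1) ^ j * coord i j ?y * coord i (n - j) ?x)"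
      unfolding \<omega>_def
    proof (rule sum.mono_neutral_right)
      show "\<forall>j\<in>{1..n-1} - {1}. (-1) ^ j * coord i j ?y * coord i (n - j) ?x = 0"
      proof
        fix j assume j: "j \<in> {1..n-1} - {1}"
        then have "n - j \<le> n - 2" "n - j \<le> n - 1" by auto
        then have "coord i (n - j) ?x = 0"
          using zero_low[OF s _ i \<open>n - j \<le> n - 2\<close>, of 0] coord_rho_gen[OF s _ i(1), of 0 "n - j"] by auto
        then show "(-1) ^ j * coord i j ?y * coord i (n - j) ?x = 0" by simp
      qed
    qed (use n_ge in auto)
    then have om: "\<omega> i ?y ?x = - (b p 1 i 1 * b s 0 i (n - 1))"
      using coord_rho_gen[OF s _ i(1), of 0 "n - 1"] coord_rho_gen[OF p(1) _ i(1) n1(3), of 1] by simp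
    have "0 = (\<Sum>k=1..m. scale (\<omega> k ?y ?x) (e k n))"
      unfolding br0[symmetric] by (rule br_central) (use coord_of_br_zero[OF br0] in blast)
    also have "\<dots> = (\<Sum>k\<in>{q p}. scale (\<omega> k ?y ?x) (e k n))"
      using zero q[OF p(1)] by (intro sum.mono_neutral_right) auto
    also have "\<dots> = scale (- (b p 1 i 1 * b s 0 i (n - 1))) (e i n)"
      using om p by simp
    finally show ?thesis
      using Y1[OF p(1)] e_top_nonzero[OF i(1)] p by auto
  qed
  have "concentrated s (q s)" if s: "s \<in> {1..m}" for s
  proof -
    have "b s 0 i j = 0" if "i \<in> {1..m}" "j \<le> n - 1" "i \<noteq> q s" for i j
    proof (cases "j = n - 1")
      case True
      then show ?thesis using Xlast[OF s that(1,3)] by simp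
    next
      case False
      then have "j \<le> n - 2" using that by auto
      then show ?thesis using zero_low[OF s _ that(1,3)] by simp
    qed
    then show ?thesis
      unfolding concentrated_def using X1[OF s] Y0[OF s] zero_low[OF s] by auto
  qed
  then have "concentrated_endomorphism scale br n m r Ns e B \<rho> b q"
    using bij_q q(2) Y1 by unfold_locales auto
  then show thesis by (rule that)
qed

end

section \<open>The matrix conditions\<close>

text \<open>Right multiplication by a 0-1 matrix with one 1 per column selects columns. With
  \<open>c\<close> free this covers \<open>T\<close> as well as its blocks.\<close>

lemma mult_selection_matrix:
  fixes A :: "complex mat"
  assumes A: "A \<in> carrier_mat r m" and \<pi>: "\<And>j. j < c \<Longrightarrow> \<pi> j < m"
  shows "A * mat m c (\<lambda>(i, j). if i = \<pi> j then 1 else 0) = mat r c (\<lambda>(i, j). A $$ (i, \<pi> j))"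
proof (rule eq_matI)
  fix i j assume "i < dim_row (mat r c (\<lambda>(i, j). A $$ (i, \<pi> j)))" "j < dim_col (mat r c (\<lambda>(i, j). A $$ (i, \<pi> j)))"
  then have ij: "i < r" "j < c" by auto
  then have "(A * mat m c (\<lambda>(i, j). if i = \<pi> j then 1 else 0)) $$ (i, j)
      = (\<Sum>l\<in>{0..<m}. A $$ (i, l) * (if l = \<pi> j then 1 else 0))"
    using A by (simp add: scalar_prod_def)
  also have "\<dots> = (\<Sum>l\<in>{0..<m}. if l = \<pi> j then A $$ (i, \<pi> j) else 0)"
    by (intro sum.cong) auto
  also have "\<dots> = A $$ (i, \<pi> j)"
    using \<pi>[OF ij(2)] by (simp add: sum.delta)
  finally show "(A * mat m c (\<lambda>(i, j). if i = \<pi> j then 1 else 0)) $$ (i, j)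
      = mat r c (\<lambda>(i, j). A $$ (i, \<pi> j)) $$ (i, j)"
    using ij by simp
qed (use A in auto)

text \<open>The blocks are determined by the whole matrix, so the quantified
  \<open>T\<^sub>1\<close> and \<open>T\<^sub>2\<close> become explicit selection matrices.\<close>

lemma append_cols_mat_eqD:
  assumes "mat m c f = append_cols T\<^sub>1 T\<^sub>2" "T\<^sub>1 \<in> carrier_mat m r" "T\<^sub>2 \<in> carrier_mat m (c - r)" "r \<le> c"
  shows "T\<^sub>1 = mat m r f" and "T\<^sub>2 = mat m (c - r) (\<lambda>(i, j). f (i, r + j))"
proof -
  have *: "f (i, j) = (if j < r then T\<^sub>1 $$ (i, j) else T\<^sub>2 $$ (i, j - r))" if "i < m" "j < c" for i j
    using arg_cong[OF assms(1), of "\<lambda>M. M $$ (i, j)"] assms(2-4) that by (simp add: append_cols_def)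
  show "T\<^sub>1 = mat m r f"
    using assms(2,4) by (intro eq_matI) (auto simp: *)
  show "T\<^sub>2 = mat m (c - r) (\<lambda>(i, j). f (i, r + j))"
    using assms(3,4) by (intro eq_matI) (auto simp: *)
qed

context adapted_quasi_Qn
begin

definition IB :: "complex mat" where
  "IB = append_cols (1\<^sub>m r) B"

lemma IB_carrier: "IB \<in> carrier_mat r m"
  using B_carrier r_le by (auto simp: IB_def append_cols_def)

lemma IB_right: "i < r \<Longrightarrow> j < m - r \<Longrightarrow> IB $$ (i, r + j) = B $$ (i, j)"
  using B_carrier by (auto simp: IB_def append_cols_def)

lemma coord_top_IB:
  assumes i: "i \<in> {1..r}" and k: "k \<in> {1..m}"
  shows "coord i n (e k n) = IB $$ (i - 1, k - 1)"
proof -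
  have "coord i n (e k n) = (\<Sum>l=1..r. IB $$ (l - 1, k - 1) * coord i n (e l n))"
    unfolding IB_def by (subst top_expansion[OF k]) (simp add: coord_sum coord_scale)
  also have "\<dots> = (\<Sum>l=1..r. if l = i then IB $$ (i - 1, k - 1) else 0)"
    using i by (intro sum.cong refl) (auto simp: coord_top_top)
  finally show ?thesis using i by (simp add: sum.delta)
qed

end

context concentrated_endomorphism
begin

text \<open>Expanding \<open>e (r + Suc j) n\<close> through column \<open>j\<close> of
  \<open>B\<close>, applying \<open>\<rho>\<close> to the first \<open>r\<close> top vectors and
  comparing top coordinates gives column \<open>j\<close> of (5). Matrix indices start at 0, those
  of \<open>q\<close>, \<open>kval\<close> and \<open>e\<close> at 1.\<close>

lemma rho_top_gt_r_iff:
  assumes j: "j < m - r"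
  shows "\<rho> (e (r + Suc j) n) = scale (kval (r + Suc j)) (e (q (r + Suc j)) n) \<longleftrightarrow>
    (\<forall>i<r. IB $$ (i, q (r + Suc j) - 1) * kval (r + Suc j)
       = (\<Sum>l<r. IB $$ (i, q (Suc l) - 1) * kval (Suc l) * B $$ (l, j)))" (is "?L = ?rhs \<longleftrightarrow> _")
proof -
  let ?s = "r + Suc j"
  have s: "?s \<in> {1..m}" using j by auto
  have "e ?s n = (\<Sum>l=1..r. scale (IB $$ (l - 1, ?s - 1)) (e l n))"
    unfolding IB_def by (rule top_expansion[OF s])
  then have "?L = (\<Sum>l=1..r. scale (IB $$ (l - 1, ?s - 1)) (\<rho> (e l n)))"
    by (simp only: rho.sum rho.scale)
  also have "\<dots> = (\<Sum>l=1..r. scale (IB $$ (l - 1, ?s - 1) * kval l) (e (q l) n))"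
    by (intro sum.cong refl) (simp add: rho_top_le_r)
  also have "\<dots> = (\<Sum>l<r. scale (B $$ (l, j) * kval (Suc l)) (e (q (Suc l)) n))"
    using j by (simp add: sum.atLeast1_atMost_eq IB_right)
  finally have L: "?L = (\<Sum>l<r. scale (B $$ (l, j) * kval (Suc l)) (e (q (Suc l)) n))" .
  have q_Suc: "q (Suc l) \<in> {1..m}" if "l < r" for l
    using that r_le by (intro q_in) auto
  have coord_L: "coord (Suc i) n ?L = (\<Sum>l<r. IB $$ (i, q (Suc l) - 1) * kval (Suc l) * B $$ (l, j))" if "i < r" for i
    unfolding L coord_sum coord_scale using that q_Suc
    by (intro sum.cong refl) (simp add: coord_top_IB mult_ac)
  have coord_R: "coord (Suc i) n ?rhs = IB $$ (i, q ?s - 1) * kval ?s" if "i < r" for i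
    using that q_in[OF s] by (simp add: coord_scale coord_top_IB)
  have "?L = ?rhs \<longleftrightarrow> (\<forall>i<r. coord (Suc i) n ?L = coord (Suc i) n ?rhs)"
  proof
    assume *: "\<forall>i<r. coord (Suc i) n ?L = coord (Suc i) n ?rhs"
    show "?L = ?rhs"
    proof (rule coord_eqI)
      fix i k assume ik: "i \<in> {1..m}" "k \<le> n - 1"
      have "coord i k ?L = 0"
        unfolding L coord_sum coord_scale using ik q_Suc by (intro sum.neutral) (simp add: coord_top)
      moreover have "coord i k ?rhs = 0"
        using ik q_in[OF s] by (simp add: coord_scale coord_top)
      ultimately show "coord i k ?L = coord i k ?rhs" by simp
    next
      fix i assume "i \<in> {1..r}"
      then show "coord i n ?L = coord i n ?rhs"
        using *[rule_format, of "i - 1"] by auto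
    qed
  qed simp
  then show ?thesis
    using coord_L coord_R by (auto simp: eq_commute)
qed

lemma rho_top_iff_matrix:
  assumes \<pi>: "\<And>s. s < m \<Longrightarrow> q (Suc s) = Suc (\<pi> s)"
    and T: "mat m m (\<lambda>(i, j). if i = \<pi> j then 1 else 0) = append_cols T\<^sub>1 T\<^sub>2"
      "T\<^sub>1 \<in> carrier_mat m r" "T\<^sub>2 \<in> carrier_mat m (m - r)"
  shows "(\<forall>s\<in>{1..m}. \<rho> (e s n) = scale (kval s) (e (q s) n)) \<longleftrightarrow>
    IB * T\<^sub>2 * mat_diag (m - r) (\<lambda>i. kval (r + Suc i)) = IB * T\<^sub>1 * mat_diag r (\<lambda>i. kval (Suc i)) * B"
proof -
  have \<pi>_lt: "\<pi> s < m" if "s < m" for s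
    using q_in[of "Suc s"] \<pi>[OF that] that by auto
  have T1: "T\<^sub>1 = mat m r (\<lambda>(i, j). if i = \<pi> j then 1 else 0)"
    and T2: "T\<^sub>2 = mat m (m - r) (\<lambda>(i, j). if i = \<pi> (r + j) then 1 else 0)"
    using append_cols_mat_eqD[OF T r_le] by auto
  have IBT1: "IB * T\<^sub>1 = mat r r (\<lambda>(i, j). IB $$ (i, \<pi> j))"
    unfolding T1 using r_le \<pi>_lt by (intro mult_selection_matrix[OF IB_carrier]) auto
  have IBT2: "IB * T\<^sub>2 = mat r (m - r) (\<lambda>(i, j). IB $$ (i, \<pi> (r + j)))"
    unfolding T2 using \<pi>_lt by (intro mult_selection_matrix[OF IB_carrier]) auto
  have lhs: "IB * T\<^sub>2 * mat_diag (m - r) (\<lambda>i. kval (r + Suc i))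
     = mat r (m - r) (\<lambda>(i, j). IB $$ (i, \<pi> (r + j)) * kval (r + Suc j))"
    unfolding IBT2 by (subst mat_diag_mult_right[where nr = r]) (auto intro!: eq_matI)
  have "IB * T\<^sub>1 * mat_diag r (\<lambda>i. kval (Suc i)) = mat r r (\<lambda>(i, j). IB $$ (i, \<pi> j) * kval (Suc j))"
    unfolding IBT1 by (subst mat_diag_mult_right[where nr = r]) (auto intro!: eq_matI)
  then have rhs: "IB * T\<^sub>1 * mat_diag r (\<lambda>i. kval (Suc i)) * B
     = mat r (m - r) (\<lambda>(i, j). \<Sum>l<r. IB $$ (i, \<pi> l) * kval (Suc l) * B $$ (l, j))"
    using B_carrier by (auto intro!: eq_matI sum.cong simp: scalar_prod_def lessThan_atLeast0)
  have "(\<forall>s\<in>{1..m}. \<rho> (e s n) = scale (kval s) (e (q s) n)) \<longleftrightarrow>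
    (\<forall>j<m-r. \<rho> (e (r + Suc j) n) = scale (kval (r + Suc j)) (e (q (r + Suc j)) n))" (is "_ \<longleftrightarrow> ?R")
  proof
    assume R: ?R
    show "\<forall>s\<in>{1..m}. \<rho> (e s n) = scale (kval s) (e (q s) n)"
    proof
      fix s assume s: "s \<in> {1..m}"
      show "\<rho> (e s n) = scale (kval s) (e (q s) n)"
      proof (cases "s \<le> r")
        case True
        then show ?thesis using s by (intro rho_top_le_r) auto
      next
        case False
        then have "s = r + Suc (s - r - 1)" "s - r - 1 < m - r" using s by auto
        then show ?thesis using R by metis
      qed
    qed
  qed auto
  also have "\<dots> \<longleftrightarrow> (\<forall>j<m-r. \<forall>i<r. IB $$ (i, \<pi> (r + j)) * kval (r + Suc j)
       = (\<Sum>l<r. IB $$ (i, \<pi> l) * kval (Suc l) * B $$ (l, j)))"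
    using rho_top_gt_r_iff r_le by (simp add: \<pi>)
  also have "\<dots> \<longleftrightarrow> mat r (m - r) (\<lambda>(i, j). IB $$ (i, \<pi> (r + j)) * kval (r + Suc j))
     = mat r (m - r) (\<lambda>(i, j). \<Sum>l<r. IB $$ (i, \<pi> l) * kval (Suc l) * B $$ (l, j))"
    by (auto simp: mat_eq_iff)
  finally show ?thesis unfolding lhs rhs .
qed

end

text \<open>The product with the permutation matrix has entries \<open>Suc (\<pi> s)\<close>, and
  \<open>of_nat\<close> is injective into the complex numbers.\<close>

lemma permutation_row_eq_iff:
  fixes q :: "nat \<Rightarrow> nat"
  assumes \<pi>: "\<And>j. j < m \<Longrightarrow> \<pi> j < m"
  shows "mat 1 m (\<lambda>(_, s). of_nat (q (Suc s)) :: complex)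
      = mat 1 m (\<lambda>(_, s). of_nat (Suc s)) * mat m m (\<lambda>(i, j). if i = \<pi> j then 1 else 0)
    \<longleftrightarrow> (\<forall>s<m. q (Suc s) = Suc (\<pi> s))"
proof -
  have "mat 1 m (\<lambda>(_, s). of_nat (Suc s) :: complex) * mat m m (\<lambda>(i, j). if i = \<pi> j then 1 else 0)
      = mat 1 m (\<lambda>(i, j). mat 1 m (\<lambda>(_, s). of_nat (Suc s)) $$ (i, \<pi> j))"
    by (rule mult_selection_matrix) (use \<pi> in auto)
  then show ?thesis
    using \<pi> by (auto simp: mat_eq_iff simp del: of_nat_Suc)
qed

theorem theorem4p1:
  fixes scale :: "complex \<Rightarrow> 'a::ab_group_add \<Rightarrow> 'a"
    and br :: "'a \<Rightarrow> 'a \<Rightarrow> 'a"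
    and n m r :: nat
    and Ns :: "nat \<Rightarrow> 'a set"
    and e :: "nat \<Rightarrow> nat \<Rightarrow> 'a"
    and B :: "complex mat"
    and \<rho> :: "'a \<Rightarrow> 'a"
    and b :: "nat \<Rightarrow> nat \<Rightarrow> nat \<Rightarrow> nat \<Rightarrow> complex"
  assumes "complex_lie_algebra scale br"
    and "complex_lie_algebra.quasi_Qn_filiform scale br n m r Ns"
    and "complex_lie_algebra.adapted_elements scale br n m r Ns e"
    and "B \<in> carrier_mat r (m - r)"
    and "\<And>k. k \<in> {1..m} \<Longrightarrow>
           e k n = (\<Sum>i=1..r. scale (append_cols (1\<^sub>m r) B $$ (i - 1, k - 1)) (e i n))"
    and "Vector_Spaces.linear scale scale \<rho>"
    and "\<And>s t. s \<in> {1..m} \<Longrightarrow> t \<in> {0, 1} \<Longrightarrow>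
           \<rho> (e s t) = (\<Sum>i=1..m. \<Sum>j=0..n-1. scale (b s t i j) (e i j))
                     + (\<Sum>i=1..r. scale (b s t i n) (e i n))"
    and "\<And>s t. s \<in> {1..m} \<Longrightarrow> t \<in> {2..n-1} \<Longrightarrow>
           \<rho> (e s t) = br (\<rho> (e s 0)) (\<rho> (e s (t - 1)))"
    and "\<And>s. s \<in> {1..r} \<Longrightarrow> \<rho> (e s n) = - br (\<rho> (e s 1)) (\<rho> (e s (n - 1)))"
  shows "complex_lie_algebra.automorphism scale br \<rho> \<longleftrightarrow>
    (\<exists>q :: nat \<Rightarrow> nat. \<exists>T T\<^sub>1 T\<^sub>2 :: complex mat.
      \<comment> \<open>(1): \<open>q s\<close> is the only index in \<open>{1..m}\<close> with these two expansions\<close>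
      (\<forall>s\<in>{1..m}. q s \<in> {1..m} \<and>
        (\<forall>k\<in>{1..m}.
          (\<rho> (e s 0) = scale (b s 0 k 0) (e k 0)
                     + (\<Sum>i=2..n-1. scale (b s 0 k i) (e k i))
                     + (\<Sum>i=1..r. scale (b s 0 i n) (e i n)) \<and>
           \<rho> (e s 1) = (\<Sum>i=1..n-2. scale (b s 1 k i) (e k i))
                     + (\<Sum>i=1..m. scale (b s 1 i (n - 1)) (e i (n - 1)))
                     + (\<Sum>i=1..r. scale (b s 1 i n) (e i n)))
          \<longleftrightarrow> k = q s)) \<and>
      \<comment> \<open>(2)\<close>
      permutation_matrix m T \<and>
      mat 1 m (\<lambda>(_, s). of_nat (q (Suc s))) = mat 1 m (\<lambda>(_, s). of_nat (Suc s)) * T \<and>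
      \<comment> \<open>(3)\<close>
      (\<forall>s\<in>{1..m}. \<forall>p\<in>{1..m}.
        b s 0 (q s) 0 * b s 1 (q s) 1 \<noteq> 0 \<and>
        scale (b s 1 (q s) 1 * b p 1 (q s) (n - 1)) (e (q s) n)
          = scale (b s 1 (q p) (n - 1) * b p 1 (q p) 1) (e (q p) n)) \<and>
      \<comment> \<open>(4)\<close>
      (\<forall>s\<in>{1..m}. \<forall>p\<in>{3..n-2}. odd p \<longrightarrow>
        (\<Sum>j=1..p. (-1) ^ j * b s 1 (q s) j * b s 1 (q s) (p - j + 1)) = 0) \<and>
      \<comment> \<open>(5)\<close>
      T\<^sub>1 \<in> carrier_mat m r \<and> T\<^sub>2 \<in> carrier_mat m (m - r) \<and> T = append_cols T\<^sub>1 T\<^sub>2 \<and>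
      (let k = (\<lambda>i. b i 0 (q i) 0 ^ (n - 2) * b i 1 (q i) 1 ^ 2);
           K\<^sub>1 = mat_diag r (\<lambda>i. k (Suc i));
           K\<^sub>2 = mat_diag (m - r) (\<lambda>i. k (r + Suc i));
           IB = append_cols (1\<^sub>m r) B
       in IB * T\<^sub>2 * K\<^sub>2 = IB * T\<^sub>1 * K\<^sub>1 * B))"
proof -
  interpret N: adapted_endomorphism scale br n m r Ns e B \<rho> b
    using assms
    by (intro adapted_endomorphism.intro adapted_quasi_Qn.intro adapted_quasi_Qn_axioms.intro
        adapted_endomorphism_axioms.intro)
  have nf_iff: "(\<rho> (e s 0) = scale (b s 0 k 0) (e k 0)
                     + (\<Sum>i=2..n-1. scale (b s 0 k i) (e k i))
                     + (\<Sum>i=1..r. scale (b s 0 i n) (e i n)) \<and>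
           \<rho> (e s 1) = (\<Sum>i=1..n-2. scale (b s 1 k i) (e k i))
                     + (\<Sum>i=1..m. scale (b s 1 i (n - 1)) (e i (n - 1)))
                     + (\<Sum>i=1..r. scale (b s 1 i n) (e i n))) \<longleftrightarrow> N.concentrated s k"
    if "s \<in> {1..m}" "k \<in> {1..m}" for s k
    using N.normal_form_iff_concentrated[OF that] unfolding N.normal_form_def .
  \<comment> \<open>The two truncated subtractions agree since \<open>j \<le> p\<close>.\<close>
  have conv: "(\<Sum>j=1..p. (-1) ^ j * b s 1 (q s) j * b s 1 (q s) (p - j + 1))
      = (\<Sum>j=1..p. (-1) ^ j * b s 1 (q s) j * b s 1 (q s) (p + 1 - j))" for p s and q :: "nat \<Rightarrow> nat"
    by (intro sum.cong refl) (simp add: Suc_diff_le)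
  show ?thesis (is "_ \<longleftrightarrow> ?R")
  proof
    assume aut: "N.automorphism \<rho>"
    obtain q where "concentrated_endomorphism scale br n m r Ns e B \<rho> b q"
      using N.automorphism_imp_concentrated[OF aut] .
    then interpret Q: concentrated_endomorphism scale br n m r Ns e B \<rho> b q .
    \<comment> \<open>The permutation behind \<open>T\<close> is \<open>q\<close> in 0-based
      indices, extended by the identity as \<open>permutes\<close> requires.\<close>
    define \<pi> where "\<pi> j = (if j < m then q (Suc j) - 1 else j)" for j
    have q_\<pi>: "q (Suc j) = Suc (\<pi> j)" if "j < m" for j
      using Q.q_in[of "Suc j"] that by (auto simp: \<pi>_def)
    have \<pi>_lt: "\<pi> j < m" if "j < m" for j
      using Q.q_in[of "Suc j"] q_\<pi>[OF that] that by auto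
    have \<pi>_perm: "\<pi> permutes {..<m}"
    proof (rule bij_imp_permutes)
      have "inj_on \<pi> {..<m}"
        using q_\<pi> Q.q_eq_iff by (intro inj_onI) (metis Suc_le_eq Suc_inject atLeastAtMost_iff le_add1 lessThan_iff plus_1_eq_Suc)
      then show "bij_betw \<pi> {..<m} {..<m}"
        using \<pi>_lt by (intro bij_betw_imageI endo_inj_surj) auto
    qed (simp add: \<pi>_def)
    define T where "T = mat m m (\<lambda>(i, j). if i = \<pi> j then 1 else 0 :: complex)"
    define T\<^sub>1 where "T\<^sub>1 = mat m r (\<lambda>(i, j). T $$ (i, j))"
    define T\<^sub>2 where "T\<^sub>2 = mat m (m - r) (\<lambda>(i, j). T $$ (i, r + j))"
    have carrier: "T\<^sub>1 \<in> carrier_mat m r" "T\<^sub>2 \<in> carrier_mat m (m - r)"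
      by (simp_all add: T\<^sub>1_def T\<^sub>2_def)
    have app: "T = append_cols T\<^sub>1 T\<^sub>2"
      using N.r_le by (auto simp: append_cols_def T\<^sub>1_def T\<^sub>2_def T_def intro!: eq_matI)
    \<comment> \<open>Uniqueness in (1): for \<open>k \<noteq> q s\<close>,
      \<open>concentrated s k\<close> would make \<open>b s 0 (q s) 0\<close> zero.\<close>
    have c1: "N.concentrated s k \<longleftrightarrow> k = q s" if "s \<in> {1..m}" "k \<in> {1..m}" for s k
      using Q.conc[OF that(1)] Q.b_nonzero[OF that(1)] Q.q_in[OF that(1)]
      by (auto simp: N.concentrated_def)
    note iff = Q.automorphism_iff[THEN iffD1, OF aut]
    have matrix_eq: "N.IB * T\<^sub>2 * mat_diag (m - r) (\<lambda>i. Q.kval (r + Suc i))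
        = N.IB * T\<^sub>1 * mat_diag r (\<lambda>i. Q.kval (Suc i)) * B"
      using Q.rho_top_iff_matrix[of \<pi> T\<^sub>1 T\<^sub>2, OF q_\<pi> app[unfolded T_def] carrier] iff by blast
    show ?R
    proof (rule exI[of _ q], rule exI[of _ T], rule exI[of _ T\<^sub>1], rule exI[of _ T\<^sub>2],
        intro conjI, goal_cases)
      case 1
      show ?case by (intro ballI conjI Q.q_in trans[OF nf_iff c1])
    next
      case 2
      show ?case unfolding permutation_matrix_def using \<pi>_perm T_def by blast
    next
      case 3
      show ?case unfolding T_def using permutation_row_eq_iff[of m \<pi> q, OF \<pi>_lt] q_\<pi> by blast
    next
      case 4
      show ?case using iff Q.b_nonzero by blast
    next
      case 5
      show ?case using iff unfolding Q.conv_def conv by blast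
    next
      case 9
      show ?case using matrix_eq unfolding Let_def Q.kval_def N.IB_def .
    qed (fact carrier app)+
  next
    assume ?R
    then show "N.automorphism \<rho>"
    proof (elim exE conjE, goal_cases)
      case h: (1 q T T\<^sub>1 T\<^sub>2)
      obtain \<pi> where \<pi>: "\<pi> permutes {..<m}" and T: "T = mat m m (\<lambda>(i, j). if i = \<pi> j then 1 else 0)"
        using h(2) unfolding permutation_matrix_def by blast
      have \<pi>_lt: "\<pi> j < m" if "j < m" for j
        using permutes_in_image[OF \<pi>, of j] that by simp
      have q_\<pi>: "q (Suc j) = Suc (\<pi> j)" if "j < m" for j
        using h(3) permutation_row_eq_iff[of m \<pi> q, OF \<pi>_lt] that unfolding T by blast
      have "inj_on q {1..m}"
      proof (rule inj_onI)
        fix s p assume sp: "s \<in> {1..m}" "p \<in> {1..m}" "q s = q p"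
        then have "Suc (\<pi> (s - 1)) = Suc (\<pi> (p - 1))"
          using q_\<pi>[of "s - 1"] q_\<pi>[of "p - 1"] by auto
        then have "s - 1 = p - 1" using permutes_inj[OF \<pi>] by (simp add: inj_eq)
        then show "s = p" using sp by auto
      qed
      then have bij: "bij_betw q {1..m} {1..m}"
        using h(1) by (intro bij_betw_imageI endo_inj_surj) auto
      have "N.concentrated s (q s)" if s: "s \<in> {1..m}" for s
        using nf_iff[OF s] h(1) s by blast
      then interpret Q: concentrated_endomorphism scale br n m r Ns e B \<rho> b q
        using bij h(4) by unfold_locales blast+
      have "\<forall>s\<in>{1..m}. \<rho> (e s n) = scale (Q.kval s) (e (q s) n)"
        using h(9) Q.rho_top_iff_matrix[of \<pi> T\<^sub>1 T\<^sub>2, OF q_\<pi> h(8)[unfolded T] h(6,7)]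
        unfolding Let_def Q.kval_def N.IB_def by blast
      then show ?case
        using Q.automorphism_iff h(4,5) unfolding Q.conv_def conv by blast
    qed
  qed
qed

end
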